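(* Thompson's group $V$ is PA'-recognizable.
   Context: Thompson's group $V$ is the group of all right-continuous bijections of $[0,1)$ (with $0$ and $1$ identified) that map dyadic rationals to dyadic rationals, are differentiable except at finitely many dyadic rationals, and are affine on each interval of differentiability with slope a power of $2$; equivalently, the group of homeomorphisms of the Cantor space $\{0,1\}^{\mathbb{N}}$ of the form $u_i x\mapsto v_i x$ ($i=1,\dots,n$), for complete finite prefix codes $\{u_1,\dots,u_n\}$, $\{v_1,\dots,v_n\}$ over $\{0,1\}$. PA'-recognizability: let $\mathcal F=\{f_i:B_i\to B_i',\ i=1,\dots,k\}$ be a finite set of piecewise affine rational homeomorphisms, where each $B_i$ and $B_i'$ is a finite union of bounded (closed) rational polytopes of $\mathbb{R}^n$ (for a common $n$); that is, each $f_i$ is a homeomorphism and $B_i$ is a finite union of bounded rational polytopes on each of which $f_i$ is of the form $x\mapsto Mx+b$ with $M,b$ having rational entries. Let $S_{\mathcal F}$ be the closure of $\{f_i,f_i^{-1}\}$ under composition of partial functions (elements of $S_{\mathcal F}$ are partial maps, defined wherever the composition makes sense, possibly with empty domain). Let $T_{\mathcal F}$ be the common domain (the intersection of the domains) of all functions in $S_{\mathcal F}$. The group generated by $\mathcal F$ is $G_{\mathcal F}=\{f_{|T_{\mathcal F}}: f\in S_{\mathcal F}\}$, a group of bijections of $T_{\mathcal F}$ under composition. A finitely generated group $G$ is PA'-recognizable if there is such a finite set $\mathcal F$ with: (A) $G$ is isomorphic to $G_{\mathcal F}$; (B) for every $t\in T_{\mathcal F}$ and $g\in G_{\mathcal F}$,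 if $g(f(t))=f(t)$ for all $f\in G_{\mathcal F}$, then $g$ is the identity. *)

theory Defs
  imports
    "HOL-Analysis.Analysis"
    "HOL-Algebra.Algebra"
    "HOL-Library.Sublist"
    "HOL-Library.Omega_Words_Fun"
begin

section \<open>Thompson's group V\<close>

definition complete_finite_prefix_code :: "bool list set \<Rightarrow> bool" where
  "complete_finite_prefix_code U \<longleftrightarrow>
     finite U \<and>
     (\<forall>u\<in>U. \<forall>v\<in>U. Sublist.prefix u v \<longrightarrow> u = v) \<and>
     (\<forall>x :: bool word. \<exists>u\<in>U. \<exists>y. x = u \<frown> y)"

text \<open>
  The Cantor space is the type \<^typ>\<open>bool word\<close>, that is \<^typ>\<open>nat \<Rightarrow> bool\<close>, with the product
  topology of its class instance (\<^typ>\<open>bool\<close> being discrete). Matching enumerations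
  of two codes by a common index set amount to a bijection \<open>\<sigma>\<close> between them.
\<close>

definition thompson_V :: "(bool word \<Rightarrow> bool word) monoid" where
  "thompson_V =
     \<lparr>carrier = {g. homeomorphic_map euclidean euclidean g \<and>
        (\<exists>U W \<sigma>. complete_finite_prefix_code U \<and> complete_finite_prefix_code W \<and>
           bij_betw \<sigma> U W \<and> (\<forall>u\<in>U. \<forall>x. g (u \<frown> x) = \<sigma> u \<frown> x))},
      mult = (\<circ>),
      one = id\<rparr>"

section \<open>Piecewise affine rational homeomorphisms\<close>

text \<open>
  The dimension \<open>n\<close> is existentially quantified in the definition of recognizability, so
  \<open>\<real>\<^sup>n\<close> is taken to be \<^term>\<open>Euclidean_space n\<close>, whose points are the sequences of
  reals that vanish at all indices \<open>i \<ge> n\<close>.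
\<close>

text \<open>The set \<open>H\<close> lists the inequalities \<open>a \<bullet> x \<le> c\<close>.\<close>

definition bounded_rational_polytope :: "nat \<Rightarrow> (nat \<Rightarrow> real) set \<Rightarrow> bool" where
  "bounded_rational_polytope n P \<longleftrightarrow>
     (\<exists>H :: ((nat \<Rightarrow> real) \<times> real) set.
        finite H \<and> (\<forall>(a, c)\<in>H. (\<forall>i<n. a i \<in> \<rat>) \<and> c \<in> \<rat>) \<and>
        P = {x \<in> topspace (Euclidean_space n). \<forall>(a, c)\<in>H. (\<Sum>i<n. a i * x i) \<le> c}) \<and>
     (\<exists>R. \<forall>x\<in>P. \<forall>i<n. \<bar>x i\<bar> \<le> R)"

definition polytopal_cover :: "nat \<Rightarrow> (nat \<Rightarrow> real) set set \<Rightarrow> (nat \<Rightarrow> real) set \<Rightarrow> bool" where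
  "polytopal_cover n \<P> B \<longleftrightarrow>
     finite \<P> \<and> (\<forall>P\<in>\<P>. bounded_rational_polytope n P) \<and> B = \<Union>\<P>"

definition rational_affine_on ::
    "nat \<Rightarrow> (nat \<Rightarrow> real) set \<Rightarrow> ((nat \<Rightarrow> real) \<Rightarrow> (nat \<Rightarrow> real)) \<Rightarrow> bool" where
  "rational_affine_on n P f \<longleftrightarrow>
     (\<exists>(M :: nat \<Rightarrow> nat \<Rightarrow> real) (b :: nat \<Rightarrow> real).
        (\<forall>i<n. \<forall>j<n. M i j \<in> \<rat>) \<and> (\<forall>i<n. b i \<in> \<rat>) \<and>
        (\<forall>x\<in>P. \<forall>i<n. f x i = (\<Sum>j<n. M i j * x j) + b i))"

text \<open>A homeomorphism \<open>f : B \<rightarrow> B'\<close> is encoded as a partial map with domain \<open>B\<close> and range \<open>B'\<close>.\<close>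

definition pa_rational_homeo :: "nat \<Rightarrow> ((nat \<Rightarrow> real) \<rightharpoonup> (nat \<Rightarrow> real)) \<Rightarrow> bool" where
  "pa_rational_homeo n f \<longleftrightarrow>
     homeomorphic_map (subtopology (Euclidean_space n) (dom f))
                      (subtopology (Euclidean_space n) (ran f)) (\<lambda>x. the (f x)) \<and>
     (\<exists>\<P>. polytopal_cover n \<P> (dom f) \<and>
          (\<forall>P\<in>\<P>. rational_affine_on n P (\<lambda>x. the (f x)))) \<and>
     (\<exists>\<Q>. polytopal_cover n \<Q> (ran f))"

section \<open>Recognizability\<close>

text \<open>Meaningful for \<open>f\<close> injective on its domain.\<close>

definition partial_inverse :: "('a \<rightharpoonup> 'b) \<Rightarrow> ('b \<rightharpoonup> 'a)" where
  "partial_inverse f =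
     (\<lambda>y. if y \<in> ran f then Some (THE x. f x = Some y) else None)"

inductive_set composition_closure :: "('a \<rightharpoonup> 'a) set \<Rightarrow> ('a \<rightharpoonup> 'a) set"
  for F :: "('a \<rightharpoonup> 'a) set" where
  generator: "f \<in> F \<Longrightarrow> f \<in> composition_closure F"
| inverse_generator: "f \<in> F \<Longrightarrow> partial_inverse f \<in> composition_closure F"
| composition: "g \<in> composition_closure F \<Longrightarrow> h \<in> composition_closure F \<Longrightarrow>
    g \<circ>\<^sub>m h \<in> composition_closure F"

definition common_domain :: "('a \<rightharpoonup> 'a) set \<Rightarrow> 'a set" where
  "common_domain F = (\<Inter>f\<in>composition_closure F. dom f)"

definition restricted_group :: "('a \<rightharpoonup> 'a) set \<Rightarrow> ('a \<rightharpoonup> 'a) monoid" where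
  "restricted_group F =
     \<lparr>carrier = {f |` common_domain F |f. f \<in> composition_closure F},
      mult = (\<circ>\<^sub>m),
      one = Some |` common_domain F\<rparr>"

definition finitely_generated_group :: "('a, 'b) monoid_scheme \<Rightarrow> bool" where
  "finitely_generated_group G \<longleftrightarrow>
     group G \<and> (\<exists>S. finite S \<and> S \<subseteq> carrier G \<and> generate G S = carrier G)"

definition PA'_recognizable :: "('a, 'b) monoid_scheme \<Rightarrow> bool" where
  "PA'_recognizable G \<longleftrightarrow>
     finitely_generated_group G \<and>
     (\<exists>n F. finite F \<and> (\<forall>f\<in>F. pa_rational_homeo n f) \<and>
        G \<cong> restricted_group F \<and>
        (\<forall>t\<in>common_domain F. \<forall>g\<in>carrier (restricted_group F).
           (\<forall>f\<in>carrier (restricted_group F). (g \<circ>\<^sub>m f) t = f t) \<longrightarrow>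
           g = \<one>\<^bsub>restricted_group F\<^esub>))"

end

theory Submission
  imports Defs
begin

text \<open>
  Every element of \<open>V\<close> is a bijection of the Cantor space that, for some \<open>n\<close>, replaces each prefix of
  length \<open>n\<close> by another word. Sending \<open>x\<close> to \<open>\<Sum>i. 2 x\<^sub>i / 3\<^sup>i\<^sup>+\<^sup>1\<close> places the Cantor space in \<open>[0, 1]\<close>, the
  words with prefix \<open>u\<close> being those in the \<open>u\<close>-th ternary interval \<open>I\<^sub>u\<close>. Replacing a prefix \<open>u\<close> by \<open>v\<close> is
  then the restriction of the affine bijection of \<open>I\<^sub>u\<close> onto \<open>I\<^sub>v\<close>, and intervals of incomparable words are
  disjoint. So each generator extends to a homeomorphism between finite unions of disjoint
  intervals, in dimension one.

  The common domain \<open>T\<close> of all compositions has to be brought down to the Cantor set exactly, since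
  otherwise compositions that agree on the Cantor set could differ on \<open>T\<close>. All generators
  are taken with the same depth \<open>N\<close>, so \<open>T\<close> lies in the union \<open>C\<^sub>N\<close> of the intervals of words of length
  \<open>N\<close>. If every word of length three is shortened to one of length two by some generator, then
  each interval of a word of length \<open>n \<ge> N\<close> is enlarged by a generator to that of a word of length
  \<open>n - 1\<close>; as \<open>T\<close> is invariant, \<open>T \<subseteq> C\<^sub>n\<close> gives \<open>T \<subseteq> C\<^sub>n\<^sub>+\<^sub>1\<close> (\<open>common_domain_in_segments\<close>,
  \<open>common_domain_eq\<close>). Restricting to \<open>T\<close> now identifies \<open>G\<close> with \<open>V\<close> acting on the Cantor space.
  Condition (B) holds because a nontrivial element moves every point of some cone, while every
  orbit meets every cone (\<open>thompson_V_faithful_on_orbit\<close>).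

  Finite generation rests on the involutions \<open>(u v)\<close> that swap the cones of two incomparable words.
  They generate \<open>V\<close>: using swaps inside the range code, one may carry the images of two siblings \<open>p0\<close>,
  \<open>p1\<close> of the domain code to siblings \<open>q0\<close>, \<open>q1\<close>, and then merge each pair, which makes both codes
  smaller (\<open>thompson_V_generated_by_swaps\<close>). Finitely many swaps and finitely many elements shortening
  pairs of words then suffice, because if \<open>g\<close> carries \<open>u\<close>, \<open>v\<close> to \<open>u'\<close>, \<open>v'\<close> then \<open>(u v)\<close> is the conjugate
  of \<open>(u' v')\<close> by \<open>g\<close> (\<open>thompson_V_generators\<close>).
\<close>

\<comment> \<open>From here on \<open>inv\<close> is the inverse of a function; group inverses are written \<open>m_inv\<close>.\<close>
unbundle no m_inv_syntax

\<comment> \<open>Keep words written as finite prefixes, instead of unfolding them letter by letter.\<close>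
declare build_cons [simp del] build_append [simp del]

section \<open>Prefix replacement on the Cantor space\<close>

definition cone_map :: "(bool word \<Rightarrow> bool word) \<Rightarrow> bool list \<Rightarrow> bool list \<Rightarrow> bool" where
  "cone_map g u v \<longleftrightarrow> (\<forall>x. g (u \<frown> x) = v \<frown> x)"

definition prefix_replacing :: "nat \<Rightarrow> (bool word \<Rightarrow> bool word) \<Rightarrow> bool" where
  "prefix_replacing n g \<longleftrightarrow> (\<forall>u. length u = n \<longrightarrow> (\<exists>v. cone_map g u v))"

lemma conc_eq_conc_shorter:
  assumes "u \<frown> x = v \<frown> y" and "length u \<le> length v"
  obtains w where "v = u @ w" and "x = w \<frown> y"
proof -
  have "v = take (length u) v @ drop (length u) v" by simp
  then have "u \<frown> x = take (length u) v \<frown> (drop (length u) v \<frown> y)"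
    using assms(1) by simp
  moreover have "length u = length (take (length u) v)" using assms(2) by simp
  ultimately have "u = take (length u) v" "x = drop (length u) v \<frown> y"
    by blast+
  then show thesis using that by (metis append_take_drop_id)
qed

lemma parallel_conc_neq: "u \<parallel> v \<Longrightarrow> u \<frown> x \<noteq> v \<frown> y"
  by (metis conc_eq_conc_shorter nat_le_linear parallel_def prefixI)

lemma parallelI_conc:
  assumes "\<And>x y. u \<frown> x \<noteq> v \<frown> y"
  shows "u \<parallel> v"
  by (rule parallelI) (metis assms conc_conc prefixE)+

lemma parallel_if_length_eq: "length u = length v \<Longrightarrow> u \<noteq> v \<Longrightarrow> u \<parallel> v"
  using not_equal_is_parallel by metis

text \<open>
  Otherwise one word is a proper extension \<open>u @ w\<close> of the other, and a sequence avoiding the first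
  letter of \<open>w\<close> is a counterexample.
\<close>

lemma conc_inject_all:
  assumes "\<And>x. u \<frown> x = v \<frown> x"
  shows "u = (v :: bool list)"
proof -
  have *: "u = v" if le: "length u \<le> length v" and eq: "\<And>x. u \<frown> x = v \<frown> x"
    for u v :: "bool list"
  proof -
    obtain w where w: "v = u @ w"
      using conc_eq_conc_shorter[OF eq le] by metis
    have "w = []"
    proof (rule ccontr)
      assume "w \<noteq> []"
      define x where "x = (\<lambda>n::nat. \<not> hd w)"
      have "u \<frown> x = u \<frown> (w \<frown> x)"
        using eq[of x] w by (simp only: conc_conc)
      then have "x 0 = (w \<frown> x) 0" by (simp only: same_concat_eq)
      then show False using \<open>w \<noteq> []\<close> by (simp add: x_def hd_conv_nth)
    qed
    then show "u = v" using w by simp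
  qed
  show ?thesis
    using *[of u v] *[of v u] assms by (metis nat_le_linear)
qed

lemma cone_mapD: "cone_map g u v \<Longrightarrow> g (u \<frown> x) = v \<frown> x"
  by (simp add: cone_map_def)

lemma cone_map_unique: "cone_map g u v \<Longrightarrow> cone_map g u v' \<Longrightarrow> v = v'"
  by (rule conc_inject_all) (metis cone_mapD)

lemma cone_map_append: "cone_map g u v \<Longrightarrow> cone_map g (u @ w) (v @ w)"
  by (simp add: cone_map_def flip: conc_conc)

lemma cone_map_comp: "cone_map g u v \<Longrightarrow> cone_map h v w \<Longrightarrow> cone_map (h \<circ> g) u w"
  by (simp add: cone_map_def)

lemma cone_map_inv: "bij g \<Longrightarrow> cone_map g u v \<Longrightarrow> cone_map (inv g) v u"
  unfolding cone_map_def by (metis bij_inv_eq_iff)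

text \<open>
  Incomparable words are those with disjoint cones, and an injection keeps these disjoint.
\<close>

lemma cone_map_parallel:
  assumes "bij g" "cone_map g u u'" "cone_map g v v'" "u \<parallel> v"
  shows "u' \<parallel> v'"
proof (rule parallelI_conc)
  fix x y
  have "g (u \<frown> x) \<noteq> g (v \<frown> y)"
    using parallel_conc_neq[OF assms(4)] bij_is_inj[OF assms(1)] by (simp add: inj_eq)
  then show "u' \<frown> x \<noteq> v' \<frown> y"
    by (simp add: cone_mapD[OF assms(2)] cone_mapD[OF assms(3)])
qed

lemma split_word: "x = prefix n x \<frown> suffix n x" for x :: "bool word"
  by simp

lemma prefix_replacing_obtain:
  assumes "prefix_replacing n g" "length u = n"
  obtains v where "cone_map g u v"
  using assms unfolding prefix_replacing_def by blast

lemma prefix_replacingE: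
  assumes "prefix_replacing n g"
  obtains v where "cone_map g (prefix n x) v" "g x = v \<frown> suffix n x"
proof -
  obtain v where v: "cone_map g (prefix n x) v"
    using prefix_replacing_obtain[OF assms, of "prefix n x"] by auto
  have "g x = v \<frown> suffix n x"
    using cone_mapD[OF v, of "suffix n x"] by simp
  with v show thesis by (rule that)
qed

lemma prefix_replacing_mono:
  assumes "prefix_replacing m g" "m \<le> n"
  shows "prefix_replacing n g"
  unfolding prefix_replacing_def
proof (intro allI impI)
  fix u :: "bool list" assume "length u = n"
  then have "length (take m u) = m" using assms(2) by simp
  then obtain v where "cone_map g (take m u) v"
    using prefix_replacing_obtain[OF assms(1)] by blast
  then have "cone_map g (take m u @ drop m u) (v @ drop m u)" by (rule cone_map_append)
  then show "\<exists>v. cone_map g u v" by auto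
qed

lemma open_if_finitely_determined:
  fixes S :: "bool word set"
  assumes "\<And>x y. x \<in> S \<Longrightarrow> (\<forall>i<n. x i = y i) \<Longrightarrow> y \<in> S"
  shows "open S"
proof (subst open_subopen, intro ballI)
  fix x assume "x \<in> S"
  define T where "T = (PiE UNIV (\<lambda>i. if i < n then {x i} else UNIV) :: bool word set)"
  have "open T"
    unfolding T_def
  proof (rule open_PiE)
    show "open (if i < n then {x i} else UNIV)" for i by (simp add: open_discrete)
    have "{i. (if i < n then {x i} else UNIV) \<noteq> UNIV} \<subseteq> {..<n}" by auto
    then show "finite {i. (if i < n then {x i} else UNIV) \<noteq> UNIV}"
      by (rule finite_subset) simp
  qed
  moreover have "x \<in> T" by (auto simp: T_def)
  moreover have "T \<subseteq> S"
  proof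
    fix y assume y: "y \<in> T"
    have "x i = y i" if "i < n" for i
      using y that by (auto simp: T_def PiE_iff split: if_splits dest: spec[of _ i])
    then show "y \<in> S" using assms[OF \<open>x \<in> S\<close>] by blast
  qed
  ultimately show "\<exists>T. open T \<and> x \<in> T \<and> T \<subseteq> S" by blast
qed

text \<open>
  A prefix replacement is computed letter by letter with bounded look-ahead. Both the continuity of
  the elements of \<open>V\<close> and the fact that a nontrivial element moves a whole cone come from this.
\<close>

lemma prefix_replacing_local:
  assumes "prefix_replacing n g" and eq: "\<forall>j<n + i + 1. x j = y j"
  shows "g x i = g y i"
proof -
  have pre: "prefix n x = prefix n y"
    using eq by (auto simp: subsequence_def)
  obtain v where v: "cone_map g (prefix n x) v" "g x = v \<frown> suffix n x"
    by (rule prefix_replacingE[OF assms(1)])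
  have "g y = v \<frown> suffix n y"
    using cone_mapD[OF v(1), of "suffix n y"] by (simp add: pre)
  with v(2) eq show ?thesis by (cases "i < length v") simp_all
qed

lemma prefix_replacing_continuous:
  assumes "prefix_replacing n g"
  shows "continuous_on UNIV g"
proof (rule continuous_on_coordinatewise_then_product)
  fix i
  have "open ((\<lambda>x. g x i) -` B)" for B
  proof (rule open_if_finitely_determined)
    fix x y assume "x \<in> (\<lambda>x. g x i) -` B" "\<forall>j<n + i + 1. x j = y j"
    then show "y \<in> (\<lambda>x. g x i) -` B" using prefix_replacing_local[OF assms, of i x y] by simp
  qed
  then show "continuous_on UNIV (\<lambda>x. g x i)"
    by (simp add: continuous_on_open_vimage)
qed

lemma prefix_replacing_comp:
  assumes "prefix_replacing m g" "prefix_replacing n h"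
  shows "prefix_replacing (m + n) (h \<circ> g)"
  unfolding prefix_replacing_def
proof (intro allI impI)
  fix u :: "bool list" assume len: "length u = m + n"
  then obtain v where "cone_map g (take m u) v"
    using assms(1) unfolding prefix_replacing_def by (metis length_take min_absorb2 le_add1)
  then have g: "cone_map g u (v @ drop m u)"
    using cone_map_append[of g "take m u" v "drop m u"] by simp
  have "prefix_replacing (length (v @ drop m u)) h"
    using assms(2) by (rule prefix_replacing_mono) (simp add: len)
  then obtain w where "cone_map h (v @ drop m u) w"
    using prefix_replacing_obtain by blast
  then show "\<exists>w. cone_map (h \<circ> g) u w"
    using cone_map_comp[OF g] by blast
qed

lemma finite_words_of_length: "finite {u :: bool list. length u = n}"
  using finite_lists_length_eq[of "UNIV :: bool set" n] by simp

lemma finite_words_of_length_le: "finite {u :: bool list. length u \<le> n}"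
  using finite_lists_length_le[of "UNIV :: bool set" n] by simp

text \<open>
  The words that replace the prefixes form a complete code as well, so beyond their maximal length
  \<open>m\<close> every word extends one of them and the replacement can be undone.
\<close>

lemma prefix_replacing_inv:
  assumes "bij g" "prefix_replacing n g"
  obtains m where "prefix_replacing m (inv g)"
proof -
  obtain \<sigma> where \<sigma>: "cone_map g u (\<sigma> u)" if "length u = n" for u
    using assms(2) unfolding prefix_replacing_def by metis
  define m where "m = Max ((\<lambda>u. length (\<sigma> u)) ` {u. length u = n})"
  have m: "length (\<sigma> u) \<le> m" if "length u = n" for u
    unfolding m_def by (rule Max_ge) (use that finite_words_of_length in auto)
  have "prefix_replacing m (inv g)"
    unfolding prefix_replacing_def
  proof (intro allI impI)
    fix v :: "bool list" assume len: "length v = m"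
    define x where "x = inv g (v \<frown> (\<lambda>_. False))"
    have "g x = v \<frown> (\<lambda>_. False)"
      using assms(1) by (simp add: x_def bij_is_surj surj_f_inv_f)
    moreover have "g x = \<sigma> (prefix n x) \<frown> suffix n x"
      using cone_mapD[OF \<sigma>, of "prefix n x" "suffix n x"] by simp
    ultimately have "\<sigma> (prefix n x) \<frown> suffix n x = v \<frown> (\<lambda>_. False)" by simp
    then obtain w where "v = \<sigma> (prefix n x) @ w"
      by (rule conc_eq_conc_shorter) (simp add: m len)
    then have "cone_map (inv g) v (prefix n x @ w)"
      using cone_map_append[OF cone_map_inv[OF assms(1) \<sigma>, of "prefix n x"]] by simp
    then show "\<exists>w. cone_map (inv g) v w" by blast
  qed
  then show thesis by (rule that)
qed

text \<open>
  The domain code consists of all words of length \<open>n\<close>; injectivity of \<open>g\<close> makes their replacements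
  prefix-free, and surjectivity makes them complete.
\<close>

lemma thompson_V_code:
  assumes "bij g" "prefix_replacing n g"
  shows "\<exists>U W \<sigma>. complete_finite_prefix_code U \<and> complete_finite_prefix_code W \<and>
           bij_betw \<sigma> U W \<and> (\<forall>u\<in>U. \<forall>x. g (u \<frown> x) = \<sigma> u \<frown> x)"
proof -
  obtain \<sigma> where \<sigma>: "cone_map g u (\<sigma> u)" if "length u = n" for u
    using assms(2) unfolding prefix_replacing_def by metis
  define U where "U = {u :: bool list. length u = n}"
  have U: "complete_finite_prefix_code U"
    unfolding complete_finite_prefix_code_def
  proof (intro conjI allI ballI impI)
    show "finite U" unfolding U_def by (rule finite_words_of_length)
    show "u = v" if "u \<in> U" "v \<in> U" "Sublist.prefix u v" for u v
      using that by (auto simp: U_def prefix_def)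
    show "\<exists>u\<in>U. \<exists>y. x = u \<frown> y" for x
      unfolding U_def by (metis (mono_tags) word_split mem_Collect_eq)
  qed
  have prefix_eq: "u = u'" if "u \<in> U" "u' \<in> U" "Sublist.prefix (\<sigma> u) (\<sigma> u')" for u u'
  proof (rule ccontr)
    assume "u \<noteq> u'"
    then have "u \<parallel> u'" using that parallel_if_length_eq by (auto simp: U_def)
    then have "\<sigma> u \<parallel> \<sigma> u'"
      using cone_map_parallel[OF assms(1) \<sigma> \<sigma>] that by (auto simp: U_def)
    then show False using that(3) by (auto simp: parallel_def)
  qed
  have "inj_on \<sigma> U" using prefix_eq by (auto simp: inj_on_def)
  then have bij: "bij_betw \<sigma> U (\<sigma> ` U)" by (simp add: bij_betw_def)
  have "complete_finite_prefix_code (\<sigma> ` U)"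
    unfolding complete_finite_prefix_code_def
  proof (intro conjI allI ballI impI)
    show "finite (\<sigma> ` U)" using U by (simp add: complete_finite_prefix_code_def)
    show "v = w" if "v \<in> \<sigma> ` U" "w \<in> \<sigma> ` U" "Sublist.prefix v w" for v w
      using that prefix_eq by auto
    fix x
    obtain y where y: "x = g y" using assms(1) by (metis bij_pointE)
    have "x = \<sigma> (prefix n y) \<frown> suffix n y"
      using cone_mapD[OF \<sigma>, of "prefix n y" "suffix n y"] by (simp add: y)
    then show "\<exists>v\<in>\<sigma> ` U. \<exists>z. x = v \<frown> z"
      by (intro bexI[of _ "\<sigma> (prefix n y)"] exI) (auto simp: U_def)
  qed
  then show ?thesis
    using U bij \<sigma> unfolding U_def cone_map_def by blast
qed

text \<open>
  This description makes closure under composition and inversion visible, and it frees later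
  arguments from topology: the homeomorphism condition is a consequence.
\<close>

theorem thompson_V_iff:
  "g \<in> carrier thompson_V \<longleftrightarrow> bij g \<and> (\<exists>n. prefix_replacing n g)"
proof
  assume "g \<in> carrier thompson_V"
  then obtain U \<sigma> where hom: "homeomorphic_map euclidean euclidean g"
    and U: "complete_finite_prefix_code U" and \<sigma>: "\<And>u. u \<in> U \<Longrightarrow> cone_map g u (\<sigma> u)"
    unfolding thompson_V_def cone_map_def by auto
  have "bij g"
    using homeomorphic_imp_injective_map[OF hom] homeomorphic_imp_surjective_map[OF hom]
    by (simp add: bij_def)
  moreover have "prefix_replacing (Max (length ` U)) g"
    unfolding prefix_replacing_def
  proof (intro allI impI)
    fix u :: "bool list" assume len: "length u = Max (length ` U)"
    obtain v y where v: "v \<in> U" "v \<frown> y = u \<frown> (\<lambda>_. False)"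
      using U unfolding complete_finite_prefix_code_def by metis
    have "length v \<le> length u"
      unfolding len by (rule Max_ge) (use v U in \<open>auto simp: complete_finite_prefix_code_def\<close>)
    then obtain w where "u = v @ w" using conc_eq_conc_shorter[OF v(2)] by metis
    then show "\<exists>v. cone_map g u v" using cone_map_append[OF \<sigma>[OF v(1)]] by blast
  qed
  ultimately show "bij g \<and> (\<exists>n. prefix_replacing n g)" by blast
next
  assume "bij g \<and> (\<exists>n. prefix_replacing n g)"
  then obtain n where bij: "bij g" and n: "prefix_replacing n g" by blast
  obtain m where m: "prefix_replacing m (inv g)" by (rule prefix_replacing_inv[OF bij n])
  have "homeomorphic_maps euclidean euclidean g (inv g)"
    unfolding homeomorphic_maps_def
    using prefix_replacing_continuous[OF n] prefix_replacing_continuous[OF m] bij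
    by (simp add: bij_is_inj bij_is_surj surj_f_inv_f)
  then have "homeomorphic_map euclidean euclidean g"
    by (simp add: homeomorphic_maps_map)
  then show "g \<in> carrier thompson_V"
    using thompson_V_code[OF bij n] by (simp add: thompson_V_def)
qed

lemma thompson_V_comp:
  assumes "g \<in> carrier thompson_V" "h \<in> carrier thompson_V"
  shows "g \<circ> h \<in> carrier thompson_V"
proof -
  obtain m n where "bij g" "bij h" "prefix_replacing m g" "prefix_replacing n h"
    using assms by (auto simp: thompson_V_iff)
  then show ?thesis
    unfolding thompson_V_iff using bij_comp prefix_replacing_comp by blast
qed

lemma thompson_V_id: "id \<in> carrier thompson_V"
proof -
  have "cone_map id u u" for u by (simp add: cone_map_def)
  then show ?thesis by (auto simp: thompson_V_iff prefix_replacing_def)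
qed

lemma thompson_V_inv: "g \<in> carrier thompson_V \<Longrightarrow> inv g \<in> carrier thompson_V"
  unfolding thompson_V_iff by (metis bij_imp_bij_inv prefix_replacing_inv)

lemma thompson_V_mult [simp]: "g \<otimes>\<^bsub>thompson_V\<^esub> h = g \<circ> h"
  and thompson_V_one [simp]: "\<one>\<^bsub>thompson_V\<^esub> = id"
  by (simp_all add: thompson_V_def)

lemma thompson_V_bij: "g \<in> carrier thompson_V \<Longrightarrow> bij g"
  by (simp add: thompson_V_iff)

lemma thompson_V_group: "group thompson_V"
proof (rule groupI)
  fix g assume g: "g \<in> carrier thompson_V"
  then show "\<exists>h\<in>carrier thompson_V. h \<otimes>\<^bsub>thompson_V\<^esub> g = \<one>\<^bsub>thompson_V\<^esub>"
    using thompson_V_inv[OF g] thompson_V_bij[OF g]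
    by (intro bexI[of _ "inv g"]) (simp_all add: bij_is_inj)
qed (simp_all add: thompson_V_comp thompson_V_id comp_assoc)

lemma thompson_V_m_inv:
  assumes "g \<in> carrier thompson_V"
  shows "m_inv thompson_V g = inv g"
proof (rule group.inv_equality[OF thompson_V_group])
  show "inv g \<otimes>\<^bsub>thompson_V\<^esub> g = \<one>\<^bsub>thompson_V\<^esub>"
    using thompson_V_bij[OF assms] by (simp add: bij_is_inj)
qed (use assms thompson_V_inv in auto)

section \<open>Generation by cone swaps\<close>

definition cantor_cone :: "bool list \<Rightarrow> bool word set" where
  "cantor_cone u = range ((\<frown>) u)"

text \<open>
  The degenerate case \<open>u = v\<close> is the identity map, which saves case distinctions when elements of a
  code are permuted.
\<close>

definition cone_swap :: "bool list \<Rightarrow> bool list \<Rightarrow> bool word \<Rightarrow> bool word" where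
  "cone_swap u v x =
     (if x \<in> cantor_cone u then v \<frown> suffix (length u) x
      else if x \<in> cantor_cone v then u \<frown> suffix (length v) x else x)"

lemma parallel_not_in_cone: "u \<parallel> v \<Longrightarrow> u \<frown> x \<notin> cantor_cone v"
  using parallel_conc_neq by (auto simp: cantor_cone_def)

lemma in_coneI: "u \<frown> x \<in> cantor_cone u"
  by (simp add: cantor_cone_def)

lemma cone_swap_left: "cone_map (cone_swap u v) u v"
  by (simp add: cone_map_def cone_swap_def in_coneI)

lemma cone_swap_right: "u \<parallel> v \<Longrightarrow> cone_map (cone_swap u v) v u"
  by (simp add: cone_map_def cone_swap_def in_coneI parallel_not_in_cone parallel_commute)

lemma cone_swap_other: "w \<parallel> u \<Longrightarrow> w \<parallel> v \<Longrightarrow> cone_map (cone_swap u v) w w"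
  by (simp add: cone_map_def cone_swap_def parallel_not_in_cone)

lemma cone_swap_self: "cone_swap u u = id"
  by (auto simp: cone_swap_def cantor_cone_def fun_eq_iff)

lemma cone_swap_commute:
  assumes "u \<parallel> v"
  shows "cone_swap u v = cone_swap v u"
proof
  fix x
  have "x \<notin> cantor_cone u \<or> x \<notin> cantor_cone v"
    using parallel_not_in_cone[OF assms] by (auto simp: cantor_cone_def)
  then show "cone_swap u v x = cone_swap v u x" by (auto simp: cone_swap_def)
qed

lemma cone_swap_involution:
  assumes "u \<parallel> v"
  shows "cone_swap u v (cone_swap u v x) = x"
proof -
  consider y where "x = u \<frown> y" | y where "x = v \<frown> y" | "x \<notin> cantor_cone u" "x \<notin> cantor_cone v"
    by (auto simp: cantor_cone_def)
  then show ?thesis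
    using cone_mapD[OF cone_swap_left[of u v]] cone_mapD[OF cone_swap_right[OF assms]]
    by cases (simp_all add: cone_swap_def)
qed

lemma cone_swap_in_V:
  assumes "u \<parallel> v"
  shows "cone_swap u v \<in> carrier thompson_V"
proof -
  have "bij (cone_swap u v)"
    by (rule o_bij[where g = "cone_swap u v"]) (auto simp: cone_swap_involution[OF assms])
  moreover have "prefix_replacing (max (length u) (length v)) (cone_swap u v)"
    unfolding prefix_replacing_def
  proof (intro allI impI)
    fix w :: "bool list" assume len: "length w = max (length u) (length v)"
    consider r where "w = u @ r" | r where "w = v @ r" | "w \<parallel> u" "w \<parallel> v"
    proof (cases "Sublist.prefix u w \<or> Sublist.prefix v w")
      case True
      then show thesis using that by (auto elim: prefixE)
    next
      case False
      then have "\<not> Sublist.prefix w u" "\<not> Sublist.prefix w v"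
        using len by (metis max.cobounded1 max.cobounded2 prefix_length_le
          le_antisym prefix_order.refl not_equal_is_parallel parallelD1)+
      with False show thesis using that by blast
    qed
    then show "\<exists>w'. cone_map (cone_swap u v) w w'"
      using cone_map_append[OF cone_swap_left[of u v]]
        cone_map_append[OF cone_swap_right[OF assms]] cone_swap_other by cases blast+
  qed
  ultimately show ?thesis by (auto simp: thompson_V_iff)
qed

lemma cone_swap_conjugate:
  assumes "bij g" "u \<parallel> v" "cone_map g u u'" "cone_map g v v'"
  shows "cone_swap u v = inv g \<circ> cone_swap u' v' \<circ> g"
proof
  fix x
  have par: "u' \<parallel> v'" using cone_map_parallel assms by blast
  have "g (cone_swap u v x) = cone_swap u' v' (g x)"
  proof -
    consider y where "x = u \<frown> y" | y where "x = v \<frown> y" | "x \<notin> cantor_cone u" "x \<notin> cantor_cone v"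
      by (auto simp: cantor_cone_def)
    then show ?thesis
    proof cases
      case 3
      have "g x \<notin> cantor_cone u'" "g x \<notin> cantor_cone v'"
        using 3 assms by (auto simp: cantor_cone_def cone_map_def bij_is_inj inj_eq
          simp flip: assms(3,4)[unfolded cone_map_def, rule_format])
      then show ?thesis using 3 by (simp add: cone_swap_def)
    qed (simp_all add: cone_mapD[OF cone_swap_left] cone_mapD[OF cone_swap_right]
        assms(2) par cone_mapD[OF assms(3)] cone_mapD[OF assms(4)])
  qed
  then show "cone_swap u v x = (inv g \<circ> cone_swap u' v' \<circ> g) x"
    using assms(1) by (simp add: bij_inv_eq_iff)
qed

lemma code_parallel:
  assumes "complete_finite_prefix_code U" "u \<in> U" "v \<in> U" "u \<noteq> v"
  shows "u \<parallel> v"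
  using assms unfolding complete_finite_prefix_code_def by (blast intro: parallelI)

lemma code_obtain:
  assumes "complete_finite_prefix_code U"
  obtains u y where "u \<in> U" "x = u \<frown> y"
  using assms unfolding complete_finite_prefix_code_def by blast

lemma code_finite: "complete_finite_prefix_code U \<Longrightarrow> finite U"
  by (simp add: complete_finite_prefix_code_def)

lemma cone_swap_code:
  assumes "complete_finite_prefix_code W" "a \<in> W" "b \<in> W" "w \<in> W"
  shows "cone_map (cone_swap a b) w (Transposition.transpose a b w)"
proof (cases "a = b")
  case True
  then show ?thesis by (simp add: cone_swap_self cone_map_def)
next
  case False
  then have par: "a \<parallel> b" using code_parallel assms by blast
  consider "w = a" | "w = b" | "w \<noteq> a" "w \<noteq> b" by blast
  then show ?thesis
  proof cases
    case 3
    then show ?thesis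
      using cone_swap_other[of w a b] code_parallel[OF assms(1)] assms by simp
  qed (use cone_swap_left cone_swap_right[OF par] in auto)
qed

text \<open>
  Let \<open>u = p @ [b]\<close> be a longest word. Some word of the code is comparable with the other child of
  \<open>p\<close>; it is not longer, and as a proper prefix it would also be a prefix of \<open>u\<close>.
\<close>

lemma code_siblings:
  assumes U: "complete_finite_prefix_code U" and "card U \<ge> 2"
  obtains p where "p @ [False] \<in> U" "p @ [True] \<in> U"
proof -
  have fin: "finite U" by (rule code_finite[OF U])
  have "U \<noteq> {}" using assms(2) by auto
  then have "Max (length ` U) \<in> length ` U" using fin by (intro Max_in) auto
  then obtain u where u: "u \<in> U" "length u = Max (length ` U)" by auto
  have max: "length v \<le> length u" if "v \<in> U" for v
    unfolding u(2) using that fin by (intro Max_ge) auto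
  have "u \<noteq> []"
  proof
    assume "u = []"
    then have "U = {[]}" using max u(1) by force
    then show False using assms(2) by simp
  qed
  then obtain p b where p: "u = p @ [b]" by (metis rev_exhaust)
  obtain v y where v: "v \<in> U" "(p @ [\<not> b]) \<frown> (\<lambda>_. False) = v \<frown> y"
    by (rule code_obtain[OF U])
  then have "length v \<le> length (p @ [\<not> b])" using max p by auto
  then obtain w where w: "p @ [\<not> b] = v @ w"
    using v(2) by (metis conc_eq_conc_shorter)
  have "w = []"
  proof (rule ccontr)
    assume "w \<noteq> []"
    then have "Sublist.prefix v p" using w by (metis butlast_append butlast_snoc prefixI)
    then have "Sublist.prefix v u" using p by simp
    then have "v = u" using U u v by (auto simp: complete_finite_prefix_code_def)
    then show False using w p \<open>w \<noteq> []\<close>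
      by (metis append_assoc append_self_conv butlast_snoc length_append le_add1
        append_eq_append_conv same_append_eq snoc_eq_iff_butlast)
  qed
  then have "p @ [\<not> b] \<in> U" using w v(1) by simp
  then show thesis using that[of p] u(1) p by (cases b) auto
qed

lemma code_merge_siblings:
  assumes U: "complete_finite_prefix_code U"
    and F: "p @ [False] \<in> U" and T: "p @ [True] \<in> U"
  defines "U' \<equiv> insert p (U - {p @ [False], p @ [True]})"
  shows "complete_finite_prefix_code U'" and "p \<notin> U" and "card U = Suc (card U')"
proof -
  have fin: "finite U" by (rule code_finite[OF U])
  have pre: "u = v" if "u \<in> U" "v \<in> U" "Sublist.prefix u v" for u v
    using U that by (auto simp: complete_finite_prefix_code_def)
  show p: "p \<notin> U" using pre[of p "p @ [True]"] T by auto
  have above: "\<not> Sublist.prefix u p" if "u \<in> U" for u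
    using pre[OF that F] p that by auto
  have below: "\<not> Sublist.prefix p u" if u: "u \<in> U - {p @ [False], p @ [True]}" for u
  proof
    assume "Sublist.prefix p u"
    then obtain r where r: "u = p @ r" by (auto elim: prefixE)
    with u p obtain b s where "r = b # s" by (cases r) auto
    then have "Sublist.prefix (p @ [b]) u" using r by simp
    then have "p @ [b] = u" using pre[of "p @ [b]" u] u F T by (cases b) auto
    then show False using u by (cases b) auto
  qed
  show "complete_finite_prefix_code U'"
    unfolding complete_finite_prefix_code_def
  proof (intro conjI allI ballI impI)
    show "finite U'" using fin by (simp add: U'_def)
    show "u = v" if "u \<in> U'" "v \<in> U'" "Sublist.prefix u v" for u v
      using that pre above below by (auto simp: U'_def)
    fix x
    obtain u y where u: "u \<in> U" "x = u \<frown> y" by (rule code_obtain[OF U])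
    show "\<exists>u\<in>U'. \<exists>y. x = u \<frown> y"
    proof (cases "u \<in> {p @ [False], p @ [True]}")
      case True
      then obtain b where "u = p @ [b]" by auto
      then have "x = p \<frown> ([b] \<frown> y)" using u by simp
      then show ?thesis unfolding U'_def by blast
    qed (use u in \<open>auto simp: U'_def\<close>)
  qed
  have "card {p @ [False], p @ [True]} = 2" by simp
  then have "card (U - {p @ [False], p @ [True]}) = card U - 2"
    using F T fin by (subst card_Diff_subset) auto
  moreover have "card U \<ge> 2"
    using card_mono[OF fin, of "{p @ [False], p @ [True]}"] F T by simp
  ultimately show "card U = Suc (card U')"
    using fin p by (simp add: U'_def)
qed

lemma cone_map_siblings:
  assumes "cone_map g (p @ [False]) (q @ [False])" "cone_map g (p @ [True]) (q @ [True])"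
  shows "cone_map g p q"
  unfolding cone_map_def
proof
  fix x :: "bool word"
  have x: "x = [x 0] \<frown> suffix 1 x" using split_word[of x 1] by simp
  have "g ((p @ [x 0]) \<frown> suffix 1 x) = (q @ [x 0]) \<frown> suffix 1 x"
    using assms[THEN cone_mapD] by (cases "x 0") auto
  then show "g (p \<frown> x) = q \<frown> x" using x by (metis conc_conc)
qed

lemma bij_betw_replace_two:
  assumes "bij_betw f A B" "a \<in> A" "b \<in> A" "c \<notin> A" "d \<notin> B"
  shows "bij_betw (f(c := d)) (insert c (A - {a, b})) (insert d (B - {f a, f b}))"
proof -
  have "bij_betw f (A - {a, b}) (B - {f a, f b})"
    using assms by (auto simp: bij_betw_def inj_on_def)
  then have "bij_betw (f(c := d)) (A - {a, b}) (B - {f a, f b})"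
    by (rule bij_betw_cong[THEN iffD1, rotated]) (use assms in auto)
  then have "bij_betw (f(c := d)) (A - {a, b} \<union> {c}) (B - {f a, f b} \<union> {(f(c := d)) c})"
    using assms by (intro notIn_Un_bij_betw) auto
  then show ?thesis by simp
qed

lemma bij_betw_transpose: "a \<in> A \<Longrightarrow> b \<in> A \<Longrightarrow> bij_betw (Transposition.transpose a b) A A"
  by (simp add: bij_betw_transpose_iff)

text \<open>
  Induction on the size of the code. Let \<open>p0, p1\<close> be siblings in \<open>U\<close> and \<open>q0, q1\<close> siblings in \<open>W\<close>. Two
  swaps within \<open>W\<close> form a product \<open>t\<close> with \<open>t \<circ> g\<close> carrying \<open>p0\<close> to \<open>q0\<close> and \<open>p1\<close> to \<open>q1\<close>. Then it carries \<open>p\<close> to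
  \<open>q\<close>, and both pairs of siblings can be merged.
\<close>

lemma code_map_generated_by_swaps:
  assumes id: "id \<in> H" and comp: "\<And>g h. g \<in> H \<Longrightarrow> h \<in> H \<Longrightarrow> g \<circ> h \<in> H"
    and swap: "\<And>u v. u \<parallel> v \<Longrightarrow> cone_swap u v \<in> H"
  assumes "complete_finite_prefix_code U" "complete_finite_prefix_code W"
    "bij_betw \<sigma> U W" "\<And>u. u \<in> U \<Longrightarrow> cone_map g u (\<sigma> u)"
  shows "g \<in> H"
  using assms(4-)
proof (induction "card U" arbitrary: U W \<sigma> g rule: less_induct)
  case less
  note U = less.prems(1) and W = less.prems(2) and bij = less.prems(3) and g = less.prems(4)
  show ?case
  proof (cases "card U \<ge> 2")
    case False
    have "U \<noteq> {}" using code_obtain[OF U] by (metis empty_iff)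
    then have "card U = 1" using False code_finite[OF U] by (metis One_nat_def Suc_1
      card_gt_0_iff less_2_cases_iff not_le not_gr_zero)
    then obtain u where u: "U = {u}" by (auto simp: card_1_singleton_iff)
    have singleton: "a = []" if a: "complete_finite_prefix_code {a}" for a
    proof (rule ccontr)
      assume "a \<noteq> []"
      obtain y where y: "(\<lambda>_. \<not> hd a) = a \<frown> y"
        using code_obtain[OF a, of "\<lambda>_. \<not> hd a"] by (metis singletonD)
      then show False using \<open>a \<noteq> []\<close>  fun_cong[OF y, of 0] by (simp add: hd_conv_nth)
    qed
    have "W = {\<sigma> u}" using bij u by (simp add: bij_betw_def)
    then have "u = []" "\<sigma> u = []" using singleton U W u by auto
    then have "g = id" using cone_mapD[OF g, of u] u by (auto simp: fun_eq_iff)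
    then show ?thesis using id by simp
  next
    case True
    then obtain p where p: "p @ [False] \<in> U" "p @ [True] \<in> U" using code_siblings[OF U] by blast
    have "card W \<ge> 2" using True bij bij_betw_same_card by metis
    then obtain q where q: "q @ [False] \<in> W" "q @ [True] \<in> W" using code_siblings[OF W] by blast
    \<comment> \<open>The first swap brings the image \<open>a\<close> of \<open>p0\<close> to \<open>q0\<close> and may displace the image of \<open>p1\<close> to \<open>b\<close>.
       The second brings \<open>b\<close> to \<open>q1\<close> and leaves \<open>q0\<close> alone, because \<open>b \<noteq> q0\<close>.
       The permutation \<open>\<tau>\<close> records the effect of both on \<open>W\<close>.\<close>
    define a where "a = \<sigma> (p @ [False])"
    define b where "b = Transposition.transpose a (q @ [False]) (\<sigma> (p @ [True]))"
    define t where "t = cone_swap b (q @ [True]) \<circ> cone_swap a (q @ [False])"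
    define \<tau> where "\<tau> = Transposition.transpose b (q @ [True]) \<circ> Transposition.transpose a (q @ [False])"
    have aW: "a \<in> W" unfolding a_def using bij p by (auto simp: bij_betw_def)
    have \<tau>1: "bij_betw (Transposition.transpose a (q @ [False])) W W" using aW q by (intro bij_betw_transpose)
    have sW: "\<sigma> (p @ [True]) \<in> W" using bij p by (auto simp: bij_betw_def)
    then have bW: "b \<in> W" unfolding b_def using \<tau>1 by (auto simp: bij_betw_def)
    have "bij_betw \<tau> W W"
      unfolding \<tau>_def by (rule bij_betw_trans[OF \<tau>1 bij_betw_transpose[OF bW q(2)]])
    then have bij': "bij_betw (\<tau> \<circ> \<sigma>) U W" using bij by (rule bij_betw_trans[rotated])
    have t: "cone_map t w (\<tau> w)" if "w \<in> W" for w
    proof -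
      have "Transposition.transpose a (q @ [False]) w \<in> W" using \<tau>1 that by (auto simp: bij_betw_def)
      then show ?thesis
        using cone_map_comp[OF cone_swap_code[OF W aW q(1) that] cone_swap_code[OF W bW q(2)]]
        by (simp add: t_def \<tau>_def)
    qed
    have "\<sigma> (p @ [True]) \<noteq> a"
      unfolding a_def using bij p by (auto simp: bij_betw_def inj_on_def)
    then have "b \<noteq> q @ [False]" unfolding b_def by (metis transpose_apply_first transpose_involutory)
    then have \<tau>F: "\<tau> a = q @ [False]" by (simp add: \<tau>_def)
    have \<tau>T: "\<tau> (\<sigma> (p @ [True])) = q @ [True]" by (simp add: \<tau>_def flip: b_def)
    have tg: "cone_map (t \<circ> g) u ((\<tau> \<circ> \<sigma>) u)" if "u \<in> U" for u
      using cone_map_comp[OF g[OF that] t] bij that by (auto simp: bij_betw_def)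
    have "cone_map (t \<circ> g) (p @ [False]) (q @ [False])"
      using tg[OF p(1)] \<tau>F unfolding a_def comp_apply[of \<tau> \<sigma>] by metis
    moreover have "cone_map (t \<circ> g) (p @ [True]) (q @ [True])"
      using tg[OF p(2)] \<tau>T unfolding comp_apply[of \<tau> \<sigma>] by metis
    ultimately have tgp: "cone_map (t \<circ> g) p q" by (rule cone_map_siblings)
    define U' where "U' = insert p (U - {p @ [False], p @ [True]})"
    define W' where "W' = insert q (W - {q @ [False], q @ [True]})"
    note mU = code_merge_siblings[OF U p, folded U'_def]
    note mW = code_merge_siblings[OF W q, folded W'_def]
    have "t \<circ> g \<in> H"
    proof (rule less.hyps)
      show "card U' < card U" using mU by simp
      show "complete_finite_prefix_code U'" "complete_finite_prefix_code W'" using mU mW by auto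
      show "bij_betw ((\<tau> \<circ> \<sigma>)(p := q)) U' W'"
        using bij_betw_replace_two[OF bij' p mU(2) mW(2)] \<tau>F \<tau>T
        by (simp add: U'_def W'_def a_def)
      show "cone_map (t \<circ> g) u (((\<tau> \<circ> \<sigma>)(p := q)) u)" if "u \<in> U'" for u
        using that tg tgp by (auto simp: U'_def)
    qed
    moreover have swapH: "cone_swap c d \<in> H" if "c \<in> W" "d \<in> W" for c d
      using swap code_parallel[OF W that] id by (cases "c = d") (auto simp: cone_swap_self)
    moreover have swap2: "cone_swap c d \<circ> cone_swap c d = id" if "c \<in> W" "d \<in> W" for c d
      using cone_swap_involution code_parallel[OF W that]
      by (cases "c = d") (auto simp: cone_swap_self fun_eq_iff)
    have "g = cone_swap a (q @ [False]) \<circ> (cone_swap b (q @ [True]) \<circ> (t \<circ> g))"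
    proof -
      have "cone_swap a (q @ [False]) (cone_swap b (q @ [True]) (t x)) = x" for x
        unfolding t_def using fun_cong[OF swap2[OF aW q(1)]] fun_cong[OF swap2[OF bW q(2)]] by simp
      then show ?thesis by (intro ext) simp
    qed
    ultimately show ?thesis using comp swapH[OF aW q(1)] swapH[OF bW q(2)] by metis
  qed
qed

lemma thompson_V_generated_by_swaps:
  assumes "id \<in> H" and "\<And>g h. g \<in> H \<Longrightarrow> h \<in> H \<Longrightarrow> g \<circ> h \<in> H"
    and "\<And>u v. u \<parallel> v \<Longrightarrow> cone_swap u v \<in> H"
  shows "carrier thompson_V \<subseteq> H"
proof
  fix g assume "g \<in> carrier thompson_V"
  then obtain U W \<sigma> where code: "complete_finite_prefix_code U" "complete_finite_prefix_code W"
    "bij_betw \<sigma> U W" "\<And>u. u \<in> U \<Longrightarrow> cone_map g u (\<sigma> u)"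
    unfolding thompson_V_def cone_map_def by auto
  show "g \<in> H"
    by (rule code_map_generated_by_swaps[where H = H and U = U and W = W and \<sigma> = \<sigma>])
      (use assms code in blast)+
qed

section \<open>Finite generation\<close>

text \<open>
  If the words are comparable they start with the same letter, and a cone starting with the other
  letter serves as a stopover. Nonempty words are needed, as the whole space is not the image of a
  proper cone.
\<close>

lemma move_cone:
  assumes "u \<noteq> []" "v \<noteq> []"
  shows "\<exists>g\<in>carrier thompson_V. cone_map g u v"
proof (cases "u \<parallel> v")
  case True
  then show ?thesis using cone_swap_in_V cone_swap_left by blast
next
  case False
  define w where "w = [\<not> hd u]"
  have "hd u = hd v"
    using False assms by (cases u; cases v) (auto simp: Cons_parallelI1)
  then have w: "u \<parallel> w" "w \<parallel> v"
    using assms by (cases u; cases v; simp add: w_def Cons_parallelI1)+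
  have "cone_map (cone_swap w v \<circ> cone_swap u w) u v"
    by (rule cone_map_comp[OF cone_swap_left cone_swap_left])
  then show ?thesis using thompson_V_comp cone_swap_in_V w by blast
qed

lemma move_pair_into_cone:
  assumes "u \<parallel> v" "w \<parallel> u" "w \<parallel> v"
  shows "\<exists>g\<in>carrier thompson_V. cone_map g u (w @ [False]) \<and> cone_map g v (w @ [True])"
proof -
  let ?g = "cone_swap u (w @ [False])" and ?h = "cone_swap v (w @ [True])"
  have par: "w @ [b] \<parallel> u" "w @ [b] \<parallel> v" for b
    using parallel_append[of w u "[b]" "[]"] parallel_append[of w v "[b]" "[]"] assms by auto
  have "cone_map (?h \<circ> ?g) u (w @ [False])"
    by (rule cone_map_comp[OF cone_swap_left cone_swap_other])
      (use par in \<open>auto simp: parallel_if_length_eq\<close>)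
  moreover have "cone_map (?h \<circ> ?g) v (w @ [True])"
    by (rule cone_map_comp[OF cone_swap_other cone_swap_left])
      (use par assms in \<open>auto simp: parallel_commute\<close>)
  moreover have "?h \<circ> ?g \<in> carrier thompson_V"
    using par by (intro thompson_V_comp cone_swap_in_V) (auto simp: parallel_commute)
  ultimately show ?thesis by blast
qed

lemma parallel_not_Nil: "u \<parallel> v \<Longrightarrow> u \<noteq> []"
  by auto

text \<open>
  A word incomparable with both members of a pair marks free space outside them. Each pair is swapped
  into the two halves of its free cone, and one free cone is carried to the other.
\<close>

lemma move_pair:
  assumes u: "u\<^sub>1 \<parallel> u\<^sub>2" "w \<parallel> u\<^sub>1" "w \<parallel> u\<^sub>2"
    and v: "v\<^sub>1 \<parallel> v\<^sub>2" "z \<parallel> v\<^sub>1" "z \<parallel> v\<^sub>2"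
  shows "\<exists>g\<in>carrier thompson_V. cone_map g u\<^sub>1 v\<^sub>1 \<and> cone_map g u\<^sub>2 v\<^sub>2"
proof -
  obtain g where g: "g \<in> carrier thompson_V"
    "cone_map g u\<^sub>1 (w @ [False])" "cone_map g u\<^sub>2 (w @ [True])"
    using move_pair_into_cone[OF u] by blast
  obtain h where h: "h \<in> carrier thompson_V"
    "cone_map h v\<^sub>1 (z @ [False])" "cone_map h v\<^sub>2 (z @ [True])"
    using move_pair_into_cone[OF v] by blast
  obtain k where k: "k \<in> carrier thompson_V" "cone_map k w z"
    using move_cone parallel_not_Nil[OF u(2)] parallel_not_Nil[OF v(2)] by blast
  have "inv h \<circ> (k \<circ> g) \<in> carrier thompson_V"
    using g h k by (intro thompson_V_comp thompson_V_inv)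
  moreover have "cone_map (inv h \<circ> (k \<circ> g)) u\<^sub>1 v\<^sub>1" "cone_map (inv h \<circ> (k \<circ> g)) u\<^sub>2 v\<^sub>2"
    using g(2,3) cone_map_append[OF k(2)] cone_map_inv[OF thompson_V_bij[OF h(1)]] h(2,3)
    by (meson cone_map_comp)+
  ultimately show ?thesis by blast
qed

text \<open>
  The case \<open>a = d\<close> serves two words that agree on their first three letters: both become shorter.
  Otherwise the second word does not grow. In each case enough free space is left on both sides:
  \<open>a\<close> has length three, so \<open>a\<close> and \<open>d\<close> do not cover everything.
\<close>

lemma shorten_pair:
  assumes a: "length a = 3" and d: "length d \<le> 3" and ad: "a = d \<or> a \<parallel> d"
  obtains a' d' g where "length a' = 2" "length d' \<le> length d" "g \<in> carrier thompson_V"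
    "cone_map g a a'" "cone_map g d d'"
proof -
  consider "a = d" | "a \<parallel> d" "length d = 1" | "a \<parallel> d" "length d \<ge> 2"
  proof -
    have "length d \<ge> 1" if "a \<parallel> d"
      using that by (cases d) auto
    then show thesis using that ad by (metis One_nat_def Suc_1 le_antisym not_less_eq_eq)
  qed
  then show thesis
  proof cases
    case 1
    have "a \<noteq> []" "take 2 a \<noteq> []" using a by auto
    then obtain g where "g \<in> carrier thompson_V" "cone_map g a (take 2 a)"
      using move_cone by blast
    then show thesis using that[of "take 2 a" "take 2 a" g] a 1 by simp
  next
    case 2
    obtain b where b: "d = [b]" using 2(2) by (cases d) auto
    obtain a0 a1 a2 where a012: "a = [a0, a1, a2]"
      using a by (auto simp: length_Suc_conv numeral_3_eq_3)
    have a0: "a0 = (\<not> b)" using 2 a012 b by (auto simp: parallel_def)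
    \<comment> \<open>Since \<open>d\<close> is half of the space, \<open>a\<close> lies in the other half. It occupies a quarter of that half
       before the move, and half of it afterwards.\<close>
    have "\<exists>g\<in>carrier thompson_V. cone_map g a [\<not> b, True] \<and> cone_map g d [b]"
      by (rule move_pair[where w = "[\<not> b, \<not> a1]" and z = "[\<not> b, False]"])
        (use a0 a012 b in \<open>auto simp: parallel_def\<close>)
    then show thesis using that[of "[\<not> b, True]" "[b]"] b by auto
  next
    case 3
    obtain w where w: "length w = 2" "w \<noteq> take 2 a" "w \<noteq> take 2 d"
    proof -
      \<comment> \<open>Of three words of length two, at most two are prefixes of \<open>a\<close> or \<open>d\<close>.\<close>
      let ?W = "{[False, False], [False, True], [True, False]}"
      have "card (?W - {take 2 a, take 2 d}) \<ge> card ?W - card {take 2 a, take 2 d}"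
        by (rule diff_card_le_card_Diff) simp
      moreover have "card {take 2 a, take 2 d} \<le> 2" by (simp add: card_insert_if)
      ultimately have "?W - {take 2 a, take 2 d} \<noteq> {}" by auto
      then obtain w where "w \<in> ?W - {take 2 a, take 2 d}" by blast
      then show thesis by (intro that[of w]) auto
    qed
    have "w \<parallel> take 2 a" "w \<parallel> take 2 d"
      using w a 3 by (auto intro!: parallel_if_length_eq)
    then have "w \<parallel> a" "w \<parallel> d"
      using parallel_append[of w "take 2 a" "[]" "drop 2 a"]
        parallel_append[of w "take 2 d" "[]" "drop 2 d"] by auto
    then have "\<exists>g\<in>carrier thompson_V. cone_map g a [False, False] \<and> cone_map g d [False, True]"
      by (intro move_pair[OF 3(1), where z = "[True]"]) (auto simp: parallel_def)
    then show thesis using that[of "[False, False]" "[False, True]"] 3 by auto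
  qed
qed

text \<open>
  Swaps of words of length at most three, together with one element for each realisable way of moving
  a pair of such words. For a swap \<open>(u v)\<close> with \<open>u\<close> of length at least three, one of these elements
  shortens \<open>u\<close> without lengthening \<open>v\<close> and conjugates \<open>(u v)\<close> to a swap of smaller total length. The last
  clause is what confines the common domain to the Cantor set.
\<close>

theorem thompson_V_generators:
  "\<exists>S. finite S \<and> S \<subseteq> carrier thompson_V \<and> generate thompson_V S = carrier thompson_V \<and>
     (\<forall>u. length u = 3 \<longrightarrow> (\<exists>g\<in>S. \<exists>v. length v = 2 \<and> cone_map g u v))"
proof -
  define moves where "moves = (\<lambda>(a, d, a', d') g. g \<in> carrier thompson_V \<and>
      cone_map g a a' \<and> cone_map g d d')"
  define L where "L = {u :: bool list. length u \<le> 3}"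
  define S\<^sub>1 where "S\<^sub>1 = (\<lambda>q. SOME g. moves q g) ` {q \<in> L \<times> L \<times> L \<times> L. \<exists>g. moves q g}"
  define S\<^sub>2 where "S\<^sub>2 = (\<lambda>(u, v). cone_swap u v) ` {(u, v) \<in> L \<times> L. u \<parallel> v}"
  define S where "S = S\<^sub>1 \<union> S\<^sub>2"
  have L: "finite L" unfolding L_def by (rule finite_words_of_length_le)
  have "finite {q \<in> L \<times> L \<times> L \<times> L. \<exists>g. moves q g}"
    by (rule finite_subset[of _ "L \<times> L \<times> L \<times> L"]) (blast, simp add: L)
  moreover have "finite {(u, v) \<in> L \<times> L. u \<parallel> v}"
    by (rule finite_subset[of _ "L \<times> L"]) (blast, simp add: L)
  ultimately have "finite S\<^sub>1" "finite S\<^sub>2"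
    unfolding S\<^sub>1_def S\<^sub>2_def by simp_all
  then have fin: "finite S" by (simp add: S_def)
  have some: "moves q (SOME g. moves q g)" if "\<exists>g. moves q g" for q
    using that by (rule someI_ex)
  have "S\<^sub>1 \<subseteq> carrier thompson_V"
    using some unfolding S\<^sub>1_def by (fastforce simp: moves_def)
  moreover have "S\<^sub>2 \<subseteq> carrier thompson_V"
    unfolding S\<^sub>2_def using cone_swap_in_V by auto
  ultimately have sub: "S \<subseteq> carrier thompson_V" by (simp add: S_def)
  have shorten: "\<exists>a' d'. \<exists>g\<in>S. length a' = 2 \<and> length d' \<le> length d \<and> cone_map g a a' \<and> cone_map g d d'"
    if ad: "length a = 3" "length d \<le> 3" "a = d \<or> a \<parallel> d" for a d
  proof -
    obtain a' d' g where g: "length a' = 2" "length d' \<le> length d" "g \<in> carrier thompson_V"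
      "cone_map g a a'" "cone_map g d d'"
      by (rule shorten_pair[OF ad])
    then have ex: "\<exists>g. moves (a, d, a', d') g" by (auto simp: moves_def)
    let ?h = "SOME g. moves (a, d, a', d') g"
    have "moves (a, d, a', d') ?h" by (rule some[OF ex])
    moreover have "(a, d, a', d') \<in> L \<times> L \<times> L \<times> L" using g ad by (auto simp: L_def)
    then have "?h \<in> S" using ex unfolding S_def S\<^sub>1_def by blast
    ultimately show ?thesis using g(1,2) by (auto simp: moves_def)
  qed
  let ?H = "generate thompson_V S"
  have comp: "g \<circ> h \<in> ?H" if "g \<in> ?H" "h \<in> ?H" for g h
    using generate.eng[OF that] by simp
  have step: "cone_swap u v \<in> ?H"
    if IH: "\<And>u' v'. length u' + length v' < length u + length v \<Longrightarrow> u' \<parallel> v' \<Longrightarrow> cone_swap u' v' \<in> ?H"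
      and uv: "u \<parallel> v" and len: "length u \<ge> 3" for u v
  proof -
    \<comment> \<open>Only the first three letters matter for the choice of the generator. If \<open>v\<close> is shorter than
       that, it is not a prefix of \<open>u\<close> and so is incomparable with \<open>take 3 u\<close>.\<close>
    have "take 3 u = take 3 v \<or> take 3 u \<parallel> take 3 v"
    proof (cases "length v \<ge> 3")
      case True
      then show ?thesis using len parallel_if_length_eq[of "take 3 u" "take 3 v"] by auto
    next
      case False
      have "take 3 u \<parallel> v"
      proof (rule parallelI)
        show "\<not> Sublist.prefix (take 3 u) v" using False len by (auto dest: prefix_length_le)
        show "\<not> Sublist.prefix v (take 3 u)"
          using uv take_is_prefix prefix_order.trans by (metis parallelD2)
      qed
      then show ?thesis using False by simp
    qed
    then obtain a' d' g where g: "g \<in> S" "length a' = 2" "length d' \<le> length (take 3 v)"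
      "cone_map g (take 3 u) a'" "cone_map g (take 3 v) d'"
      using shorten[of "take 3 u" "take 3 v"] len by auto
    have V: "g \<in> carrier thompson_V" using g(1) sub by blast
    have maps: "cone_map g u (a' @ drop 3 u)" "cone_map g v (d' @ drop 3 v)"
      using cone_map_append[OF g(4), of "drop 3 u"] cone_map_append[OF g(5), of "drop 3 v"]
      by simp_all
    have "cone_swap (a' @ drop 3 u) (d' @ drop 3 v) \<in> ?H"
    proof (rule IH)
      show "a' @ drop 3 u \<parallel> d' @ drop 3 v"
        by (rule cone_map_parallel[OF thompson_V_bij[OF V] maps uv])
    qed (use g len in auto)
    moreover have "inv g \<in> ?H"
      using generate.inv[OF g(1), of thompson_V] thompson_V_m_inv[OF V] by simp
    ultimately show ?thesis
      unfolding cone_swap_conjugate[OF thompson_V_bij[OF V] uv maps]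
      using comp[OF comp generate.incl[OF g(1)]] by blast
  qed
  have "cone_swap u v \<in> ?H" if "u \<parallel> v" for u v
    using that
  proof (induction "length u + length v" arbitrary: u v rule: less_induct)
    case less
    consider "length u \<ge> 3" | "length v \<ge> 3" | "u \<in> L" "v \<in> L"
      unfolding L_def by fastforce
    then show ?case
    proof cases
      case 1
      show ?thesis by (rule step[OF less.hyps less.prems 1])
    next
      case 2
      have "cone_swap v u \<in> ?H"
      proof (rule step[OF _ _ 2])
        show "v \<parallel> u" using less.prems by (simp add: parallel_commute)
        show "cone_swap u' v' \<in> ?H" if "length u' + length v' < length v + length u" "u' \<parallel> v'" for u' v'
          using that by (intro less.hyps) auto
      qed
      then show ?thesis using cone_swap_commute[OF less.prems] by simp
    next
      case 3
      then have "cone_swap u v \<in> S" using less.prems by (auto simp: S_def S\<^sub>2_def)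
      then show ?thesis by (rule generate.incl)
    qed
  qed
  then have "carrier thompson_V \<subseteq> ?H"
    using comp generate.one[of thompson_V S] by (intro thompson_V_generated_by_swaps) auto
  then have "?H = carrier thompson_V"
    using group.generate_incl[OF thompson_V_group sub] by blast
  moreover have "\<exists>g\<in>S. \<exists>v. length v = 2 \<and> cone_map g u v" if "length u = 3" for u
    using shorten[OF that, of u] that by auto
  ultimately show ?thesis using fin sub by blast
qed

section \<open>The ternary Cantor set\<close>

text \<open>
  The affine bijection of \<open>[0, 1]\<close> onto the ternary interval of \<open>u\<close>.
\<close>

primrec cantor_affine :: "bool list \<Rightarrow> real \<Rightarrow> real" where
  "cantor_affine [] r = r"
| "cantor_affine (b # u) r = (2 * of_bool b + cantor_affine u r) / 3"

definition cantor_value :: "bool word \<Rightarrow> real" where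
  "cantor_value x = suminf (\<lambda>i. 2 * of_bool (x i) / 3 ^ Suc i)"

lemma cantor_affine_append: "cantor_affine (u @ v) r = cantor_affine u (cantor_affine v r)"
  by (induction u) simp_all

lemma cantor_affine_eq: "cantor_affine u r = cantor_affine u 0 + r / 3 ^ length u"
  by (induction u) (simp_all add: field_simps)

lemma cantor_affine_inject [simp]: "cantor_affine u r = cantor_affine u s \<longleftrightarrow> r = s"
  using cantor_affine_eq[of u r] cantor_affine_eq[of u s] by simp

lemma cantor_affine_le [simp]: "cantor_affine u r \<le> cantor_affine u s \<longleftrightarrow> r \<le> s"
  using cantor_affine_eq[of u r] cantor_affine_eq[of u s] by (simp add: divide_le_cancel)

lemma cantor_affine_0_rational: "cantor_affine u 0 \<in> \<rat>"
  by (induction u) (auto simp del: of_bool_eq split: split_of_bool)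

lemma cantor_affine_unit: "r \<in> {0..1} \<Longrightarrow> cantor_affine u r \<in> {0..1}"
  by (induction u) auto

lemma cantor_affine_image: "cantor_affine u ` {0..1} = {cantor_affine u 0..cantor_affine u 1}"
proof
  show "cantor_affine u ` {0..1} \<subseteq> {cantor_affine u 0..cantor_affine u 1}"
    by auto
  show "{cantor_affine u 0..cantor_affine u 1} \<subseteq> cantor_affine u ` {0..1}"
  proof
    fix y assume y: "y \<in> {cantor_affine u 0..cantor_affine u 1}"
    let ?s = "(y - cantor_affine u 0) * 3 ^ length u"
    have "?s \<in> {0..1}"
      using y cantor_affine_eq[of u 1] by (auto simp: field_simps)
    moreover have "y = cantor_affine u ?s" using cantor_affine_eq[of u ?s] by simp
    ultimately show "y \<in> cantor_affine u ` {0..1}" by blast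
  qed
qed

text \<open>
  At the first difference the two values lie in opposite outer thirds of a common interval.
\<close>

lemma cantor_affine_parallel:
  assumes "u \<parallel> v" and r: "r \<in> {0..1}" and s: "s \<in> {0..1}"
  shows "cantor_affine u r \<noteq> cantor_affine v s"
proof -
  obtain w b bs c cs where w: "b \<noteq> c" "u = w @ b # bs" "v = w @ c # cs"
    using parallel_decomp[OF assms(1)] by blast
  have "cantor_affine bs r \<in> {0..1}" "cantor_affine cs s \<in> {0..1}"
    using cantor_affine_unit[OF r] cantor_affine_unit[OF s] by blast+
  then show ?thesis
    using w(1) unfolding w(2,3) cantor_affine_append
    by (cases b; cases c) auto
qed

lemma cantor_value_summable: "summable (\<lambda>i. 2 * of_bool (x i) / 3 ^ Suc i :: real)"
proof (rule summable_comparison_test')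
  show "summable (\<lambda>i. 2 / 3 * (1 / 3) ^ i :: real)"
    by (intro summable_mult summable_geometric) simp
qed (simp add: field_simps of_bool_def)

lemma cantor_value_unit: "cantor_value x \<in> {0..1}"
proof -
  have "(\<lambda>i. 2 / 3 * (1 / 3) ^ i :: real) sums (2 / 3 * (1 / (1 - 1 / 3)))"
    by (intro sums_mult geometric_sums) simp
  then have s: "(\<lambda>i. 2 / 3 * (1 / 3) ^ i :: real) sums 1" by simp
  have "cantor_value x \<le> suminf (\<lambda>i. 2 / 3 * (1 / 3) ^ i)"
    unfolding cantor_value_def
    by (rule suminf_le[OF _ cantor_value_summable sums_summable[OF s]])
      (simp add: field_simps of_bool_def)
  then have "cantor_value x \<le> 1" using sums_unique[OF s] by simp
  moreover have "0 \<le> cantor_value x"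
    unfolding cantor_value_def by (rule suminf_nonneg[OF cantor_value_summable]) simp
  ultimately show ?thesis by simp
qed

lemma cantor_value_first:
  "cantor_value x = (2 * of_bool (x 0) + cantor_value (suffix 1 x)) / 3"
proof -
  have "cantor_value x = suminf (\<lambda>i. 2 * of_bool (x (Suc i)) / 3 ^ Suc (Suc i)) + 2 * of_bool (x 0) / 3"
    unfolding cantor_value_def using suminf_split_head[OF cantor_value_summable[of x]] by simp
  also have "suminf (\<lambda>i. 2 * of_bool (x (Suc i)) / 3 ^ Suc (Suc i)) = cantor_value (suffix 1 x) / 3"
    unfolding cantor_value_def
    using suminf_divide[OF cantor_value_summable[of "suffix 1 x"], of 3] by (simp add: mult.commute)
  finally show ?thesis by (simp add: add_divide_distrib)
qed

lemma cantor_value_conc: "cantor_value (u \<frown> x) = cantor_affine u (cantor_value x)"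
proof (induction u)
  case (Cons b u)
  have "suffix 1 ((b # u) \<frown> x) = u \<frown> x" by simp
  then show ?case using Cons cantor_value_first[of "(b # u) \<frown> x"] by simp
qed simp

lemma cantor_value_split: "cantor_value x = cantor_affine (prefix n x) (cantor_value (suffix n x))"
  using cantor_value_conc[of "prefix n x" "suffix n x"] by simp

lemma inj_cantor_value: "inj cantor_value"
proof (rule injI, rule ccontr)
  fix x y assume eq: "cantor_value x = cantor_value y" and "x \<noteq> y"
  then obtain i where "x i \<noteq> y i" by auto
  then have "prefix (Suc i) x \<parallel> prefix (Suc i) y"
    by (intro parallel_if_length_eq) auto
  then show False
    using cantor_affine_parallel[OF _ cantor_value_unit cantor_value_unit] eq
    by (metis cantor_value_split)
qed

text \<open>
  By disjointness, the ternary interval of each depth that contains \<open>r\<close> is unique, so the words of these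
  intervals extend one another. They are the prefixes of a sequence whose value differs from \<open>r\<close> by at
  most \<open>3\<^sup>-\<^sup>n\<close> for every \<open>n\<close>.
\<close>

lemma cantor_value_surj:
  assumes "\<And>n. \<exists>u. length u = n \<and> r \<in> cantor_affine u ` {0..1}"
  shows "r \<in> range cantor_value"
proof -
  obtain u where u: "length (u n) = n" "r \<in> cantor_affine (u n) ` {0..1}" for n
    using assms by metis
  define x where "x i = u (Suc i) ! i" for i
  have take: "take n (u (Suc n)) = u n" for n
  proof (rule ccontr)
    assume "take n (u (Suc n)) \<noteq> u n"
    then have "take n (u (Suc n)) \<parallel> u n"
      by (rule parallel_if_length_eq[rotated]) (simp add: u)
    then have "take n (u (Suc n)) @ drop n (u (Suc n)) \<parallel> u n @ []"
      by (rule parallel_append)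
    then have "u (Suc n) \<parallel> u n" by simp
    then show False using cantor_affine_parallel u(2)[of n] u(2)[of "Suc n"] by fastforce
  qed
  have pre: "prefix n x = u n" for n
  proof (induction n)
    case (Suc n)
    have "u (Suc n) = take n (u (Suc n)) @ [u (Suc n) ! n]"
      using u(1)[of "Suc n"] by (metis lessI order_refl take_Suc_conv_app_nth take_all)
    then show ?case using Suc take[of n] by (simp add: x_def)
  qed (use u(1)[of 0] in simp)
  have close: "\<bar>r - cantor_value x\<bar> \<le> (1 / 3) ^ n" for n
  proof -
    obtain s where s: "s \<in> {0..1}" "r = cantor_affine (u n) s" using u(2) by blast
    define t where "t = cantor_value (suffix n x)"
    have t: "t \<in> {0..1}" "cantor_value x = cantor_affine (u n) t"
      unfolding t_def using cantor_value_unit cantor_value_split[of x n] pre by auto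
    have "\<bar>s - t\<bar> \<le> 1" using s t by auto
    moreover have "r - cantor_value x = (s - t) / 3 ^ n"
      using s(2) t(2) cantor_affine_eq[of "u n" s] cantor_affine_eq[of "u n" t] u(1)[of n]
      by (simp add: diff_divide_distrib)
    ultimately show ?thesis by (simp add: power_one_over divide_simps)
  qed
  have "(\<lambda>n. (1 / 3 :: real) ^ n) \<longlonglongrightarrow> 0" by (intro LIMSEQ_power_zero) simp
  then have "\<bar>r - cantor_value x\<bar> \<le> 0"
    by (rule LIMSEQ_le_const) (use close in blast)
  then show ?thesis by simp
qed

section \<open>Piecewise affine maps between unions of ternary intervals\<close>

definition line :: "real \<Rightarrow> nat \<Rightarrow> real" where
  "line r = (\<lambda>i. if i = 0 then r else 0)"

definition segment :: "bool list \<Rightarrow> (nat \<Rightarrow> real) set" where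
  "segment u = (\<lambda>s. line (cantor_affine u s)) ` {0..1}"

text \<open>
  A pair \<open>(u, v)\<close> is an instruction to replace \<open>u\<close> by \<open>v\<close>. The condition is symmetric, so the converse
  table describes the inverse map.
\<close>

definition prefix_table :: "(bool list \<times> bool list) set \<Rightarrow> bool" where
  "prefix_table R \<longleftrightarrow> finite R \<and> pairwise (\<lambda>p q. fst p \<parallel> fst q \<and> snd p \<parallel> snd q) R"

text \<open>
  The graph of the piecewise affine map that carries each interval \<open>I\<^sub>u\<close> onto \<open>I\<^sub>v\<close>.
\<close>

definition table_rel :: "(bool list \<times> bool list) set \<Rightarrow> (nat \<Rightarrow> real) \<Rightarrow> (nat \<Rightarrow> real) \<Rightarrow> bool" where
  "table_rel R p q \<longleftrightarrow> (\<exists>(u, v)\<in>R. \<exists>s\<in>{0..1}.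
     p = line (cantor_affine u s) \<and> q = line (cantor_affine v s))"

definition table_map :: "(bool list \<times> bool list) set \<Rightarrow> (nat \<Rightarrow> real) \<rightharpoonup> (nat \<Rightarrow> real)" where
  "table_map R p = (if \<exists>q. table_rel R p q then Some (SOME q. table_rel R p q) else None)"

lemma line_inject [simp]: "line r = line s \<longleftrightarrow> r = s"
  by (auto simp: line_def fun_eq_iff)

lemma line_0 [simp]: "line r 0 = r"
  by (simp add: line_def)

lemma prefix_tableD:
  assumes "prefix_table R" "(u, v) \<in> R" "(u', v') \<in> R" "(u, v) \<noteq> (u', v')"
  shows "u \<parallel> u' \<and> v \<parallel> v'"
  using assms unfolding prefix_table_def pairwise_def by (metis fst_conv snd_conv)

lemma prefix_table_converse: "prefix_table R \<Longrightarrow> prefix_table (R\<inverse>)"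
  unfolding prefix_table_def pairwise_def by (clarsimp, metis fst_conv snd_conv)

lemma table_rel_converse: "table_rel (R\<inverse>) p q \<longleftrightarrow> table_rel R q p"
  by (auto simp: table_rel_def)

lemma table_rel_unique:
  assumes R: "prefix_table R" and "table_rel R p q" "table_rel R p q'"
  shows "q = q'"
proof -
  obtain u v s where 1: "(u, v) \<in> R" "s \<in> {0..1}" "p = line (cantor_affine u s)"
    "q = line (cantor_affine v s)"
    using assms(2) unfolding table_rel_def by blast
  obtain u' v' s' where 2: "(u', v') \<in> R" "s' \<in> {0..1}" "p = line (cantor_affine u' s')"
    "q' = line (cantor_affine v' s')"
    using assms(3) unfolding table_rel_def by blast
  have eq: "cantor_affine u s = cantor_affine u' s'" using 1(3) 2(3) by simp
  then have "\<not> u \<parallel> u'" using cantor_affine_parallel 1(2) 2(2) by blast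
  then have "(u, v) = (u', v')" using prefix_tableD[OF R 1(1) 2(1)] by blast
  then show ?thesis using eq 1(4) 2(4) by simp
qed

lemma table_map_eq_Some:
  assumes "prefix_table R"
  shows "table_map R p = Some q \<longleftrightarrow> table_rel R p q"
proof (cases "\<exists>q. table_rel R p q")
  case True
  then obtain q' where q': "table_rel R p q'" by blast
  then have "table_map R p = Some q'"
    unfolding table_map_def using table_rel_unique[OF assms] by (metis someI)
  then show ?thesis using q' table_rel_unique[OF assms] by (metis option.inject)
qed (auto simp: table_map_def)

lemma table_mapI:
  assumes "prefix_table R" "(u, v) \<in> R" "s \<in> {0..1}"
  shows "table_map R (line (cantor_affine u s)) = Some (line (cantor_affine v s))"
  unfolding table_map_eq_Some[OF assms(1)] table_rel_def using assms(2,3) by blast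

lemma dom_table_map:
  assumes "prefix_table R"
  shows "dom (table_map R) = (\<Union>(u, v)\<in>R. segment u)"
  by (auto simp: dom_def table_map_eq_Some[OF assms] table_rel_def segment_def)

lemma ran_table_map:
  assumes "prefix_table R"
  shows "ran (table_map R) = dom (table_map (R\<inverse>))"
  by (auto simp: dom_def ran_def table_map_eq_Some[OF assms]
      table_map_eq_Some[OF prefix_table_converse[OF assms]] table_rel_converse)

lemma partial_inverse_table_map:
  assumes "prefix_table R"
  shows "partial_inverse (table_map R) = table_map (R\<inverse>)"
proof
  fix q
  note R' = prefix_table_converse[OF assms]
  show "partial_inverse (table_map R) q = table_map (R\<inverse>) q"
  proof (cases "table_map (R\<inverse>) q")
    case None
    then show ?thesis
      by (auto simp: partial_inverse_def ran_table_map[OF assms])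
  next
    case (Some p)
    have "table_map R p' = Some q \<longleftrightarrow> p' = p" for p'
      using Some by (metis assms R' option.inject table_map_eq_Some table_rel_converse)
    then show ?thesis using Some by (auto simp: partial_inverse_def ran_def)
  qed
qed

lemma segment_polytope: "bounded_rational_polytope 1 (segment u)"
proof -
  let ?H = "{(\<lambda>_::nat. 1, cantor_affine u 1), (\<lambda>_. -1, - cantor_affine u 0)} :: ((nat \<Rightarrow> real) \<times> real) set"
  have "cantor_affine u 1 \<in> \<rat>"
    using cantor_affine_eq[of u 1] cantor_affine_0_rational[of u] by (simp add: Rats_add Rats_divide)
  then have rat: "finite ?H \<and> (\<forall>(a, c)\<in>?H. (\<forall>i<1. a i \<in> \<rat>) \<and> c \<in> \<rat>)"
    using cantor_affine_0_rational[of u] by simp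
  have seg: "segment u = line ` {cantor_affine u 0..cantor_affine u 1}"
    unfolding segment_def cantor_affine_image[symmetric] by (simp add: image_image)
  have "x = line (x 0)" if "x \<in> topspace (Euclidean_space 1)" for x
    using that by (auto simp: topspace_Euclidean_space line_def fun_eq_iff)
  moreover have "line r \<in> topspace (Euclidean_space 1)" for r
    by (auto simp: topspace_Euclidean_space line_def)
  ultimately have "segment u = {x \<in> topspace (Euclidean_space 1). \<forall>(a, c)\<in>?H. (\<Sum>i<1. a i * x i) \<le> c}"
    unfolding seg by (auto simp: image_iff intro!: bexI)
  moreover have "\<forall>x\<in>segment u. \<forall>i<1. \<bar>x i\<bar> \<le> 1"
    using cantor_affine_unit[of _ u] by (auto simp: segment_def)
  ultimately show ?thesis
    unfolding bounded_rational_polytope_def using rat by blast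
qed

lemma polytopal_cover_dom_table_map:
  assumes "prefix_table R"
  shows "polytopal_cover 1 (segment ` fst ` R) (dom (table_map R))"
  using assms segment_polytope unfolding dom_table_map[OF assms]
  by (auto simp: polytopal_cover_def prefix_table_def image_iff)

lemma table_map_on_segment:
  assumes "prefix_table R" "(u, v) \<in> R" "p \<in> segment u"
  shows "the (table_map R p) = line (3 ^ length u / 3 ^ length v * (p 0 - cantor_affine u 0) + cantor_affine v 0)"
proof -
  obtain s where s: "s \<in> {0..1}" "p = line (cantor_affine u s)"
    using assms(3) by (auto simp: segment_def)
  show ?thesis
    using table_mapI[OF assms(1,2) s(1)] s(2) cantor_affine_eq[of u s] cantor_affine_eq[of v s]
    by simp
qed

lemma table_map_rational_affine:
  assumes "prefix_table R" "(u, v) \<in> R"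
  shows "rational_affine_on 1 (segment u) (\<lambda>p. the (table_map R p))"
  unfolding rational_affine_on_def
proof (intro exI conjI)
  let ?m = "3 ^ length u / 3 ^ length v :: real"
  let ?b = "cantor_affine v 0 - ?m * cantor_affine u 0"
  show "\<forall>i<1. \<forall>j<1. (\<lambda>_ _. ?m) i j \<in> \<rat>" by (simp add: Rats_divide)
  show "\<forall>i<1. (\<lambda>_. ?b) i \<in> \<rat>"
    by (simp add: cantor_affine_0_rational Rats_diff Rats_mult Rats_divide)
  show "\<forall>p\<in>segment u. \<forall>i<1. the (table_map R p) i = (\<Sum>j<1. (\<lambda>_ _. ?m) i j * p j) + (\<lambda>_. ?b) i"
    by (simp add: table_map_on_segment[OF assms] right_diff_distrib)
qed

lemma continuous_on_line [continuous_intros]: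
  assumes "continuous_on A f"
  shows "continuous_on A (\<lambda>x. line (f x))"
proof (rule continuous_on_coordinatewise_then_product)
  show "continuous_on A (\<lambda>x. line (f x) i)" for i
    using assms by (cases "i = 0") (simp_all add: line_def)
qed

lemma continuous_on_table_map:
  assumes "prefix_table R"
  shows "continuous_on (dom (table_map R)) (\<lambda>p. the (table_map R p))"
proof -
  have "continuous_on (\<Union>r\<in>R. segment (fst r)) (\<lambda>p. the (table_map R p))"
  proof (rule continuous_on_closed_Union)
    show "finite R" using assms by (simp add: prefix_table_def)
    fix r assume "r \<in> R"
    then have uv: "(fst r, snd r) \<in> R" by simp
    have "continuous_on {0..1} (\<lambda>s. line (cantor_affine (fst r) s))"
    proof -
      have eq: "(\<lambda>s. line (cantor_affine (fst r) s)) =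
          (\<lambda>s. line (cantor_affine (fst r) 0 + s / 3 ^ length (fst r)))"
        by (intro ext) (subst cantor_affine_eq, rule refl)
      show ?thesis by (subst eq) (intro continuous_intros, simp)
    qed
    then have "compact (segment (fst r))"
      unfolding segment_def by (rule compact_continuous_image) simp
    then show "closed (segment (fst r))" by (rule compact_imp_closed)
    have "continuous_on (segment (fst r)) (\<lambda>p. line (3 ^ length (fst r) / 3 ^ length (snd r) *
        (p 0 - cantor_affine (fst r) 0) + cantor_affine (snd r) 0))"
      by (intro continuous_on_line continuous_on_add continuous_on_mult continuous_on_diff
          continuous_on_const
          continuous_on_subset[OF continuous_on_product_coordinates subset_UNIV])
    then show "continuous_on (segment (fst r)) (\<lambda>p. the (table_map R p))"
      using table_map_on_segment[OF assms uv] by (simp cong: continuous_on_cong)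
  qed
  then show ?thesis by (simp add: dom_table_map[OF assms] case_prod_unfold)
qed

lemma subtopology_Euclidean_space_eq:
  assumes "S \<subseteq> topspace (Euclidean_space n)"
  shows "subtopology (Euclidean_space n) S = top_of_set S"
  using assms
  by (simp add: Euclidean_space_def subtopology_subtopology topspace_Euclidean_space
      euclidean_product_topology Int_absorb1)

text \<open>
  The pieces are finitely many disjoint compact intervals, so continuity is clear on each piece and
  passes to the union; the same applies to the inverse, which belongs to the converse table.
\<close>

theorem table_map_pa_rational_homeo:
  assumes "prefix_table R"
  shows "pa_rational_homeo 1 (table_map R)"
proof -
  note R' = prefix_table_converse[OF assms]
  let ?f = "table_map R" and ?g = "table_map (R\<inverse>)"
  have sub: "dom (table_map Q) \<subseteq> topspace (Euclidean_space 1)" if "prefix_table Q" for Q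
    by (auto simp: dom_table_map[OF that] segment_def topspace_Euclidean_space line_def)
  have inverse: "?f p = Some q \<longleftrightarrow> ?g q = Some p" for p q
    by (simp add: table_map_eq_Some[OF assms] table_map_eq_Some[OF R'] table_rel_converse)
  have ran: "ran ?f = dom ?g" by (rule ran_table_map[OF assms])
  have to: "the (?f p) \<in> dom ?g \<and> the (?g (the (?f p))) = p" if p: "p \<in> dom ?f" for p
  proof -
    obtain q where q: "?f p = Some q" using p by blast
    with inverse have "?g q = Some p" by blast
    with q show ?thesis by (simp add: domI)
  qed
  have ret: "the (?g q) \<in> dom ?f \<and> the (?f (the (?g q))) = q" if q: "q \<in> dom ?g" for q
  proof -
    obtain p where p: "?g q = Some p" using q by blast
    with inverse have "?f p = Some q" by blast
    with p show ?thesis by (simp add: domI)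
  qed
  have "homeomorphic_maps (top_of_set (dom ?f)) (top_of_set (dom ?g)) (\<lambda>p. the (?f p)) (\<lambda>q. the (?g q))"
    unfolding homeomorphic_maps_def
    using continuous_on_table_map[OF assms] continuous_on_table_map[OF R'] to ret
    by (auto simp: continuous_map_in_subtopology)
  then have "homeomorphic_map (subtopology (Euclidean_space 1) (dom ?f))
      (subtopology (Euclidean_space 1) (ran ?f)) (\<lambda>p. the (?f p))"
    unfolding ran subtopology_Euclidean_space_eq[OF sub[OF assms]]
      subtopology_Euclidean_space_eq[OF sub[OF R']]
    by (auto simp: homeomorphic_maps_map)
  moreover have "\<forall>P\<in>segment ` fst ` R. rational_affine_on 1 P (\<lambda>p. the (?f p))"
    using table_map_rational_affine[OF assms] by auto
  ultimately show ?thesis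
    unfolding pa_rational_homeo_def
    using polytopal_cover_dom_table_map[OF assms] polytopal_cover_dom_table_map[OF R'] ran by auto
qed

section \<open>The group acting on the Cantor set\<close>

definition cantor_point :: "bool word \<Rightarrow> nat \<Rightarrow> real" where
  "cantor_point x = line (cantor_value x)"

text \<open>
  The restriction of every composition that induces \<open>g\<close> to the common domain.
\<close>

definition action :: "(bool word \<Rightarrow> bool word) \<Rightarrow> (nat \<Rightarrow> real) \<rightharpoonup> (nat \<Rightarrow> real)" where
  "action g = (\<lambda>p. Some (cantor_point (g (inv cantor_point p)))) |` range cantor_point"

definition action_table :: "nat \<Rightarrow> (bool word \<Rightarrow> bool word) \<Rightarrow> (bool list \<times> bool list) set" where
  "action_table n g = {(u, v). length u = n \<and> cone_map g u v}"

definition induces :: "((nat \<Rightarrow> real) \<rightharpoonup> (nat \<Rightarrow> real)) \<Rightarrow> (bool word \<Rightarrow> bool word) \<Rightarrow> bool" where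
  "induces f g \<longleftrightarrow> (\<forall>x. f (cantor_point x) = Some (cantor_point (g x)))"

lemma inj_cantor_point: "inj cantor_point"
  using inj_cantor_value by (auto simp: cantor_point_def inj_def)

lemma cantor_point_inject [simp]: "cantor_point x = cantor_point y \<longleftrightarrow> x = y"
  using inj_cantor_point by (simp add: inj_eq)

lemma cantor_point_conc: "cantor_point (u \<frown> x) = line (cantor_affine u (cantor_value x))"
  by (simp add: cantor_point_def cantor_value_conc)

lemma action_cantor_point [simp]: "action g (cantor_point x) = Some (cantor_point (g x))"
  by (simp add: action_def inv_f_f[OF inj_cantor_point])

lemma action_outside: "p \<notin> range cantor_point \<Longrightarrow> action g p = None"
  by (simp add: action_def)

lemma action_comp: "action (g \<circ> h) = action g \<circ>\<^sub>m action h"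
proof
  fix p
  show "action (g \<circ> h) p = (action g \<circ>\<^sub>m action h) p"
    by (cases "p \<in> range cantor_point") (auto simp: action_outside map_comp_def)
qed

lemma action_inject: "action g = action h \<longleftrightarrow> g = h"
proof
  assume "action g = action h"
  then have "g x = h x" for x using action_cantor_point[of g x] action_cantor_point[of h x] by simp
  then show "g = h" by blast
qed simp

lemma induces_restrict: "induces f g \<Longrightarrow> f |` range cantor_point = action g"
  by (rule ext) (auto simp: induces_def restrict_map_def action_outside)

lemma induces_comp: "induces f g \<Longrightarrow> induces f' g' \<Longrightarrow> induces (f \<circ>\<^sub>m f') (g \<circ> g')"
  by (simp add: induces_def map_comp_def)

lemma prefix_table_action_table:
  assumes "bij g"
  shows "prefix_table (action_table n g)"
  unfolding prefix_table_def
proof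
  have "inj_on fst (action_table n g)"
    by (auto simp: inj_on_def action_table_def intro: cone_map_unique)
  moreover have "finite (fst ` action_table n g)"
    by (rule finite_subset[OF _ finite_words_of_length[of n]]) (auto simp: action_table_def)
  ultimately show "finite (action_table n g)" using finite_imageD by blast
  show "pairwise (\<lambda>p q. fst p \<parallel> fst q \<and> snd p \<parallel> snd q) (action_table n g)"
  proof (rule pairwiseI)
    fix p q assume pq: "p \<in> action_table n g" "q \<in> action_table n g" "p \<noteq> q"
    then have p: "length (fst p) = n" "cone_map g (fst p) (snd p)"
      and q: "length (fst q) = n" "cone_map g (fst q) (snd q)"
      by (auto simp: action_table_def)
    have "fst p \<noteq> fst q"
      using cone_map_unique[OF p(2)] q(2) pq(3) by (metis prod_eqI)
    then have "fst p \<parallel> fst q" using p(1) q(1) by (intro parallel_if_length_eq) auto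
    then show "fst p \<parallel> fst q \<and> snd p \<parallel> snd q"
      using cone_map_parallel[OF assms p(2) q(2)] by blast
  qed
qed

lemma induces_action_table:
  assumes "bij g" "prefix_replacing n g"
  shows "induces (table_map (action_table n g)) g"
  unfolding induces_def
proof
  fix x
  obtain v where v: "cone_map g (prefix n x) v" "g x = v \<frown> suffix n x"
    by (rule prefix_replacingE[OF assms(2)])
  then have "(prefix n x, v) \<in> action_table n g" by (simp add: action_table_def)
  from table_mapI[OF prefix_table_action_table[OF assms(1)] this cantor_value_unit[of "suffix n x"]]
  show "table_map (action_table n g) (cantor_point x) = Some (cantor_point (g x))"
    by (simp add: v(2) flip: cantor_point_conc)
qed

lemma induces_partial_inverse:
  assumes "prefix_table R" "bij g" "induces (table_map R) g"
  shows "induces (partial_inverse (table_map R)) (inv g)"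
  unfolding induces_def
proof
  fix x
  have "table_map R (cantor_point (inv g x)) = Some (cantor_point x)"
    using assms(2,3) by (simp add: induces_def bij_is_surj surj_f_inv_f)
  then show "partial_inverse (table_map R) (cantor_point x) = Some (cantor_point (inv g x))"
    unfolding partial_inverse_table_map[OF assms(1)]
    by (simp add: table_map_eq_Some assms(1) prefix_table_converse table_rel_converse)
qed

text \<open>
  If \<open>h\<close> moves a point, it moves all points that agree with it on a long prefix \<open>w\<close>, and the orbit of
  \<open>x\<close> meets the cone of \<open>w\<close>.
\<close>

lemma thompson_V_faithful_on_orbit:
  assumes h: "h \<in> carrier thompson_V"
    and fix_orbit: "\<And>k. k \<in> carrier thompson_V \<Longrightarrow> h (k x) = k x"
  shows "h = id"
proof (rule ccontr)
  assume "h \<noteq> id"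
  then obtain y where "h y \<noteq> y" by (auto simp: fun_eq_iff)
  then obtain i where i: "h y i \<noteq> y i" by auto
  obtain n where n: "prefix_replacing n h" using h by (auto simp: thompson_V_iff)
  define w where "w = prefix (n + i + 1) y"
  have moved: "h (w \<frown> z) \<noteq> w \<frown> z" for z
  proof -
    have agree: "\<forall>j<n + i + 1. (w \<frown> z) j = y j"
      by (simp add: w_def del: subseq_to_Suc)
    then have "h (w \<frown> z) i = h y i" by (rule prefix_replacing_local[OF n])
    moreover have "(w \<frown> z) i = y i" using agree by simp
    ultimately show ?thesis using i by metis
  qed
  have "w \<noteq> []" by (simp add: w_def)
  then obtain k where k: "k \<in> carrier thompson_V" "cone_map k (prefix 1 x) w"
    using move_cone[of "prefix 1 x" w] by auto
  have "k x = w \<frown> suffix 1 x"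
    using cone_mapD[OF k(2), of "suffix 1 x"] by (simp only: split_word[symmetric])
  then show False using fix_orbit[OF k(1)] moved by simp
qed

text \<open>
  Generators with a common depth, chosen such that a cone of depth at least three can always be
  enlarged by one generator.
\<close>

locale contracting_generators =
  fixes S :: "(bool word \<Rightarrow> bool word) set" and N :: nat
  assumes finite_S: "finite S"
    and S_in_V: "S \<subseteq> carrier thompson_V"
    and generate_S: "generate thompson_V S = carrier thompson_V"
    and N_ge_3: "N \<ge> 3"
    and replacing: "g \<in> S \<Longrightarrow> prefix_replacing N g"
    and contracting: "length u = 3 \<Longrightarrow> \<exists>g\<in>S. \<exists>v. length v = 2 \<and> cone_map g u v"
begin

definition F :: "((nat \<Rightarrow> real) \<rightharpoonup> (nat \<Rightarrow> real)) set" where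
  "F = (\<lambda>g. table_map (action_table N g)) ` S"

lemma table_in_F: "g \<in> S \<Longrightarrow> table_map (action_table N g) \<in> F"
  by (simp add: F_def)

lemma S_bij: "g \<in> S \<Longrightarrow> bij g"
  using S_in_V thompson_V_bij by blast

lemma S_nonempty: "S \<noteq> {}"
  using contracting[of "[True, True, True]"] by auto

lemma F_pa_rational_homeo: "f \<in> F \<Longrightarrow> pa_rational_homeo 1 f"
  using table_map_pa_rational_homeo prefix_table_action_table S_bij by (auto simp: F_def)

lemma generator_induces: "g \<in> S \<Longrightarrow> induces (table_map (action_table N g)) g"
  by (rule induces_action_table[OF S_bij replacing])

lemma inverse_generator_induces:
  "g \<in> S \<Longrightarrow> induces (partial_inverse (table_map (action_table N g))) (inv g)"
  by (rule induces_partial_inverse[OF prefix_table_action_table[OF S_bij] S_bij generator_induces])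

lemma closure_induces:
  assumes "f \<in> composition_closure F"
  shows "\<exists>g\<in>carrier thompson_V. induces f g"
  using assms
proof induction
  case (generator f)
  then show ?case using generator_induces S_in_V by (auto simp: F_def)
next
  case (inverse_generator f)
  then obtain g where g: "g \<in> S" "f = table_map (action_table N g)" by (auto simp: F_def)
  then show ?case
    using inverse_generator_induces[OF g(1)] thompson_V_inv S_in_V by blast
next
  case (composition f f')
  then show ?case using induces_comp thompson_V_comp by meson
qed

lemma closure_realises:
  assumes "g \<in> carrier thompson_V"
  shows "\<exists>f\<in>composition_closure F. induces f g"
  using assms unfolding generate_S[symmetric]
proof induction
  case one
  obtain g where g: "g \<in> S" using S_nonempty by blast
  let ?f = "table_map (action_table N g)"
  have "?f \<in> F" by (rule table_in_F[OF g])
  then have "partial_inverse ?f \<circ>\<^sub>m ?f \<in> composition_closure F"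
    by (intro composition_closure.intros)
  moreover have "induces (partial_inverse ?f \<circ>\<^sub>m ?f) (inv g \<circ> g)"
    by (rule induces_comp[OF inverse_generator_induces[OF g] generator_induces[OF g]])
  ultimately show ?case using S_bij[OF g]
    by (metis bij_is_inj inv_o_cancel thompson_V_one)
next
  case (incl g)
  then show ?case
    using generator_induces composition_closure.generator[OF table_in_F] by blast
next
  case (inv g)
  then have "m_inv thompson_V g = inv g" using thompson_V_m_inv S_in_V by blast
  then show ?case
    using inverse_generator_induces[OF inv] composition_closure.inverse_generator[OF table_in_F[OF inv]]
    by auto
next
  case (eng g h)
  then obtain f f' where f: "f \<in> composition_closure F" "induces f g"
    "f' \<in> composition_closure F" "induces f' h"
    by blast
  show ?case
    using composition_closure.composition[OF f(1,3)] induces_comp[OF f(2,4)]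
    by (metis thompson_V_mult)
qed

lemma range_cantor_point_subset: "range cantor_point \<subseteq> common_domain F"
  unfolding common_domain_def using closure_induces by (fastforce simp: induces_def)

lemma common_domain_invariant:
  assumes p: "p \<in> common_domain F" and f: "f \<in> composition_closure F" "f p = Some q"
  shows "q \<in> common_domain F"
  unfolding common_domain_def
proof
  fix h assume "h \<in> composition_closure F"
  then have "h \<circ>\<^sub>m f \<in> composition_closure F" using f(1) by (rule composition_closure.composition)
  then have "p \<in> dom (h \<circ>\<^sub>m f)" using p by (auto simp: common_domain_def)
  then show "q \<in> dom h" using f(2) by (auto simp: map_comp_def)
qed

lemma segment_append: "segment (u @ v) \<subseteq> segment u"
  using cantor_affine_unit[of _ v] by (auto simp: segment_def cantor_affine_append)

text \<open>
  Induction on \<open>n\<close>. A generator carries the interval of \<open>u\<close>, of length \<open>n\<close>, affinely onto that of a word of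
  length \<open>n - 1\<close>, and the image of \<open>p\<close> is again a point of the common domain. By induction hypothesis
  the image lies in a ternary interval of depth \<open>n\<close>, that is, in one of the outer thirds. Hence \<open>p\<close> lies
  in an outer third of the interval of \<open>u\<close>.
\<close>

lemma common_domain_in_segments:
  assumes "n \<ge> N" "p \<in> common_domain F"
  shows "\<exists>u. length u = n \<and> p \<in> segment u"
  using assms
proof (induction n arbitrary: p rule: dec_induct)
  case base
  obtain g where g: "g \<in> S" using S_nonempty by blast
  let ?f = "table_map (action_table N g)"
  have "?f \<in> composition_closure F"
    by (rule composition_closure.generator[OF table_in_F[OF g]])
  then have "p \<in> dom ?f" using base by (auto simp: common_domain_def)
  then show ?case
    unfolding dom_table_map[OF prefix_table_action_table[OF S_bij[OF g]]]
    by (auto simp: action_table_def)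
next
  case (step n)
  obtain u s where u: "length u = n" "s \<in> {0..1}" "p = line (cantor_affine u s)"
    using step.IH[OF step.prems] by (auto simp: segment_def)
  have "length (take 3 u) = 3" using u(1) step.hyps(1) N_ge_3 by simp
  then obtain g v where g: "g \<in> S" "length v = 2" "cone_map g (take 3 u) v"
    using contracting by blast
  let ?f = "table_map (action_table N g)"
  let ?u = "take N u" and ?v = "v @ drop 3 (take N u)"
  have "take 3 u @ drop 3 (take N u) = ?u"
    using N_ge_3 by (metis append_take_drop_id min.absorb2 take_take min.commute)
  then have "cone_map g ?u ?v" using cone_map_append[OF g(3), of "drop 3 (take N u)"] by simp
  then have "(?u, ?v) \<in> action_table N g" using u(1) step.hyps by (simp add: action_table_def)
  then have "?f (line (cantor_affine ?u (cantor_affine (drop N u) s))) =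
      Some (line (cantor_affine ?v (cantor_affine (drop N u) s)))"
    using prefix_table_action_table[OF S_bij[OF g(1)]] cantor_affine_unit[OF u(2)]
    by (intro table_mapI)
  then have fp: "?f p = Some (line (cantor_affine (?v @ drop N u) s))"
    using u(3) by (simp flip: cantor_affine_append)
  have "?f \<in> composition_closure F"
    by (rule composition_closure.generator[OF table_in_F[OF g(1)]])
  then have "line (cantor_affine (?v @ drop N u) s) \<in> common_domain F"
    using step.prems fp by (metis common_domain_invariant)
  then obtain w where w: "length w = n" "line (cantor_affine (?v @ drop N u) s) \<in> segment w"
    using step.IH by blast
  then obtain t where t: "t \<in> {0..1}" "cantor_affine (?v @ drop N u) s = cantor_affine w t"
    by (auto simp: segment_def)
  have len: "length (?v @ drop N u) = n - 1" "n \<ge> 1"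
    using g(2) u(1) step.hyps N_ge_3 by auto
  \<comment> \<open>The image lies in the intervals of both words, so the shorter word is a prefix of \<open>w\<close>, which
     adds the one letter \<open>r\<close> by which \<open>u\<close> has to be extended.\<close>
  have "\<not> ?v @ drop N u \<parallel> w" using cantor_affine_parallel[OF _ u(2) t(1)] t(2) by blast
  then have "Sublist.prefix (?v @ drop N u) w"
    using len w(1) by (auto simp: parallel_def dest: prefix_length_le)
  then obtain r where r: "w = (?v @ drop N u) @ r" by (rule prefixE)
  then have "length r = 1" using len w(1) by simp
  have "s = cantor_affine r t"
    using t(2) unfolding r cantor_affine_append[of "?v @ drop N u" r] by simp
  then have "p = line (cantor_affine (u @ r) t)" using u(3) by (simp add: cantor_affine_append)
  then have "p \<in> segment (u @ r)" using t(1) by (auto simp: segment_def)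
  then show ?case using \<open>length r = 1\<close> u(1) by (intro exI[of _ "u @ r"]) simp
qed

lemma common_domain_eq: "common_domain F = range cantor_point"
proof
  show "common_domain F \<subseteq> range cantor_point"
  proof
    fix p assume p: "p \<in> common_domain F"
    have seg: "\<exists>u. length u = n \<and> p \<in> segment u" for n
    proof -
      obtain u where u: "length u = max n N" "p \<in> segment u"
        using common_domain_in_segments[of "max n N" p] p by auto
      then have "p \<in> segment (take n u)" using segment_append[of "take n u" "drop n u"] by auto
      then show ?thesis using u(1) by (intro exI[of _ "take n u"]) simp
    qed
    obtain r where r: "p = line r" using seg[of 0] by (auto simp: segment_def)
    have "r \<in> range cantor_value"
      by (rule cantor_value_surj) (use seg in \<open>auto simp: segment_def r image_iff\<close>)
    then show "p \<in> range cantor_point" by (auto simp: r cantor_point_def)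
  qed
qed (rule range_cantor_point_subset)

lemma restricted_group_carrier: "carrier (restricted_group F) = action ` carrier thompson_V"
proof
  show "carrier (restricted_group F) \<subseteq> action ` carrier thompson_V"
    using closure_induces induces_restrict
    by (fastforce simp: restricted_group_def common_domain_eq)
  show "action ` carrier thompson_V \<subseteq> carrier (restricted_group F)"
  proof (rule image_subsetI)
    fix g assume "g \<in> carrier thompson_V"
    then obtain f where f: "f \<in> composition_closure F" "induces f g"
      using closure_realises by blast
    then have "action g = f |` common_domain F"
      using induces_restrict by (simp add: common_domain_eq)
    with f(1) show "action g \<in> carrier (restricted_group F)"
      by (auto simp: restricted_group_def)
  qed
qed

lemma thompson_V_iso: "thompson_V \<cong> restricted_group F"
proof -
  have "action \<in> hom thompson_V (restricted_group F)"
  proof (rule homI)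
    show "action g \<in> carrier (restricted_group F)" if "g \<in> carrier thompson_V" for g
      using that by (simp add: restricted_group_carrier)
    show "action (g \<otimes>\<^bsub>thompson_V\<^esub> h) = action g \<otimes>\<^bsub>restricted_group F\<^esub> action h" for g h
      by (simp add: action_comp) (simp add: restricted_group_def)
  qed
  moreover have "bij_betw action (carrier thompson_V) (carrier (restricted_group F))"
    by (simp add: bij_betw_def restricted_group_carrier inj_on_def action_inject)
  ultimately show ?thesis by (auto simp: is_iso_def iso_def)
qed

lemma faithful_on_orbits:
  assumes t: "t \<in> common_domain F" and g: "g \<in> carrier (restricted_group F)"
    and eq: "\<forall>f\<in>carrier (restricted_group F). (g \<circ>\<^sub>m f) t = f t"
  shows "g = \<one>\<^bsub>restricted_group F\<^esub>"
proof -
  obtain x where x: "t = cantor_point x" using t by (auto simp: common_domain_eq)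
  obtain h where h: "h \<in> carrier thompson_V" "g = action h"
    using g by (auto simp: restricted_group_carrier)
  have "h (k x) = k x" if "k \<in> carrier thompson_V" for k
  proof -
    have "(action h \<circ>\<^sub>m action k) (cantor_point x) = action k (cantor_point x)"
      using eq that by (simp add: restricted_group_carrier h(2) x)
    then show ?thesis by (simp flip: action_comp)
  qed
  then have "h = id" by (rule thompson_V_faithful_on_orbit[OF h(1)])
  moreover have "induces Some id" by (simp add: induces_def)
  ultimately show ?thesis
    using h(2) induces_restrict[of Some id] by (simp add: restricted_group_def common_domain_eq)
qed

theorem recognizable: "PA'_recognizable thompson_V"
  unfolding PA'_recognizable_def finitely_generated_group_def
proof (intro conjI)
  show "\<exists>S. finite S \<and> S \<subseteq> carrier thompson_V \<and> generate thompson_V S = carrier thompson_V"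
    using finite_S S_in_V generate_S by blast
  have "finite F" using finite_S by (simp add: F_def)
  then show "\<exists>n F. finite F \<and> (\<forall>f\<in>F. pa_rational_homeo n f) \<and> thompson_V \<cong> restricted_group F \<and>
      (\<forall>t\<in>common_domain F. \<forall>g\<in>carrier (restricted_group F).
        (\<forall>f\<in>carrier (restricted_group F). (g \<circ>\<^sub>m f) t = f t) \<longrightarrow> g = \<one>\<^bsub>restricted_group F\<^esub>)"
    using F_pa_rational_homeo thompson_V_iso faithful_on_orbits
    by (intro exI[of _ 1] exI[of _ F]) blast
qed (rule thompson_V_group)

end

theorem proposition5p14:
  shows "PA'_recognizable thompson_V"
proof -
  obtain S where S: "finite S" "S \<subseteq> carrier thompson_V"
    "generate thompson_V S = carrier thompson_V"
    "\<And>u. length u = 3 \<Longrightarrow> \<exists>g\<in>S. \<exists>v. length v = 2 \<and> cone_map g u v"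
    using thompson_V_generators by blast
  have "\<exists>n. prefix_replacing n g" if "g \<in> S" for g
    using that S(2) thompson_V_iff by blast
  then obtain n where n: "\<And>g. g \<in> S \<Longrightarrow> prefix_replacing (n g) g" by metis
  define N where "N = Max (insert 3 (n ` S))"
  have "3 \<le> N" unfolding N_def using S(1) by (intro Max_ge) auto
  moreover have "prefix_replacing N g" if "g \<in> S" for g
  proof (rule prefix_replacing_mono[OF n[OF that]])
    show "n g \<le> N" unfolding N_def using S(1) that by (intro Max_ge) auto
  qed
  ultimately interpret contracting_generators S N
    using S by unfold_locales auto
  show ?thesis by (rule recognizable)
qed

end
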